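(* Let $T\colon c_0\times c_0\to\mathbb{R}$, $T(x,y)=\sum_{i,j=1}^{\infty}a_{ij}x_iy_j$, be a continuous bilinear form which is an extremum for Littlewood's $4/3$ inequality (real scalars). Then $\mathcal{C}omp(T)=2$. Moreover: (1) for every $i_{1,0}\in\mathbb{N}$ and all $(i_{1,0},j_1),(i_{1,0},j_2)\in S_1^{(i_{1,0})}(T)$ one has $|a_{i_{1,0}j_1}|=|a_{i_{1,0}j_2}|$; (2) for every $i_{2,0}\in\mathbb{N}$ and all $(i_1,i_{2,0}),(i_2,i_{2,0})\in S_2^{(i_{2,0})}(T)$ one has $|a_{i_1i_{2,0}}|=|a_{i_2i_{2,0}}|$.
   Context: $c_0$ is the real Banach space of real null sequences with the sup norm, $(e_j)$ its canonical basis, and $\|T\|=\sup\{|T(x,y)|:\|x\|\le1,\|y\|\le1\}$. Littlewood's $4/3$ inequality for real scalars states that $\left(\sum_{i,j=1}^{\infty}|T(e_i,e_j)|^{4/3}\right)^{3/4}\le\sqrt2\,\|T\|$ for all continuous bilinear forms $T\colon c_0\times c_0\to\mathbb{R}$; the constant $\sqrt2$ is optimal. A continuous bilinear form $T$ is an extremum for this inequality if $\|T\|=1$ and $\left(\sum_{i,j=1}^{\infty}|T(e_i,e_j)|^{4/3}\right)^{3/4}=\sqrt2$. For $T(x,y)=\sum_{i,j}a_{ij}x_iy_j$ and $n\in\mathbb{N}$, put $S_1^{(n)}(T)=\{(n,j):j\in\mathbb{N},\ a_{nj}\ne0\}$ and $S_2^{(n)}(T)=\{(i,n):i\in\mathbb{N},\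 a_{in}\ne0\}$. The complexity of $T$ is $\mathcal{C}omp(T)=\sup_{k\in\{1,2\}}\sup_{n\in\mathbb{N}}\operatorname{card}S_k^{(n)}(T)$. *)

theory Defs
  imports "HOL-Analysis.Analysis" "HOL-Library.Extended_Nat"
begin

section \<open>The real Banach space of null sequences\<close>

text \<open>Sequences are indexed by \<^typ>\<open>nat\<close>, hence from 0 rather than from 1.\<close>

typedef c0 = "{x :: nat \<Rightarrow> real. x \<longlonglongrightarrow> 0}"
  morphisms c0_nth Abs_c0
  by (rule exI[of _ "\<lambda>_. 0"]) simp

setup_lifting type_definition_c0

lemma c0_eqI: "(\<And>n. c0_nth x n = c0_nth y n) \<Longrightarrow> x = y"
  by (metis c0_nth_inject ext)

lemma c0_nth_tendsto_0: "c0_nth x \<longlonglongrightarrow> 0"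
  using c0_nth[of x] by simp

instantiation c0 :: real_vector
begin

lift_definition zero_c0 :: c0 is "\<lambda>_. 0" by simp
lift_definition plus_c0 :: "c0 \<Rightarrow> c0 \<Rightarrow> c0" is "\<lambda>x y n. x n + y n"
  using tendsto_add by fastforce
lift_definition minus_c0 :: "c0 \<Rightarrow> c0 \<Rightarrow> c0" is "\<lambda>x y n. x n - y n"
  using tendsto_diff by fastforce
lift_definition uminus_c0 :: "c0 \<Rightarrow> c0" is "\<lambda>x n. - x n"
  using tendsto_minus by fastforce
lift_definition scaleR_c0 :: "real \<Rightarrow> c0 \<Rightarrow> c0" is "\<lambda>r x n. r * x n"
  using tendsto_mult_right_zero by blast

instance
  by standard (transfer; simp add: fun_eq_iff algebra_simps)+

end

lemmas c0_nth_simps [simp] =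
  zero_c0.rep_eq plus_c0.rep_eq minus_c0.rep_eq uminus_c0.rep_eq scaleR_c0.rep_eq

lemma c0_nth_sum: "c0_nth (sum f A) n = (\<Sum>a\<in>A. c0_nth (f a) n)"
  by (induction A rule: infinite_finite_induct) auto

lemma bdd_above_c0: "bdd_above (range (\<lambda>n. \<bar>c0_nth x n\<bar>))"
proof -
  have "Bseq (c0_nth x)"
    using c0_nth_tendsto_0 convergentI convergent_imp_Bseq by blast
  then obtain K where "\<And>n. \<bar>c0_nth x n\<bar> \<le> K"
    by (auto simp: Bseq_def)
  then show ?thesis by (auto intro: bdd_aboveI[of _ K])
qed

instantiation c0 :: real_normed_vector
begin

definition norm_c0 :: "c0 \<Rightarrow> real" where
  "norm (x :: c0) = (SUP n. \<bar>c0_nth x n\<bar>)"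

definition sgn_c0 :: "c0 \<Rightarrow> c0" where
  "sgn (x :: c0) = x /\<^sub>R norm x"

definition dist_c0 :: "c0 \<Rightarrow> c0 \<Rightarrow> real" where
  "dist (x :: c0) y = norm (x - y)"

definition uniformity_c0 :: "(c0 \<times> c0) filter" where
  "uniformity = (INF e\<in>{0<..}. principal {(x :: c0, y). dist x y < e})"

definition open_c0 :: "c0 set \<Rightarrow> bool" where
  "open (U :: c0 set) = (\<forall>x\<in>U. \<forall>\<^sub>F (x', y) in uniformity. x' = x \<longrightarrow> y \<in> U)"

lemma abs_c0_nth_le_norm: "\<bar>c0_nth x n\<bar> \<le> norm x"
  unfolding norm_c0_def by (rule cSUP_upper[OF UNIV_I bdd_above_c0])

lemma norm_c0_le: "(\<And>n. \<bar>c0_nth x n\<bar> \<le> r) \<Longrightarrow> norm x \<le> r" for x :: c0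
  unfolding norm_c0_def by (rule cSUP_least) auto

instance
proof
  fix x y :: c0 and r :: real
  show "dist x y = norm (x - y)" by (rule dist_c0_def)
  show "sgn x = x /\<^sub>R norm x" by (rule sgn_c0_def)
  show "(uniformity :: (c0 \<times> c0) filter) = (INF e\<in>{0<..}. principal {(x, y). dist x y < e})"
    by (rule uniformity_c0_def)
  show "open U = (\<forall>x\<in>U. \<forall>\<^sub>F (x', y) in uniformity. x' = x \<longrightarrow> y \<in> U)" for U :: "c0 set"
    by (rule open_c0_def)
  have "x = 0" if "norm x = 0"
    using abs_c0_nth_le_norm[of x] that by (intro c0_eqI) simp
  moreover have "norm (0 :: c0) = 0" by (simp add: norm_c0_def)
  ultimately show "norm x = 0 \<longleftrightarrow> x = 0" by blast
  show "norm (x + y) \<le> norm x + norm y"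
  proof (rule norm_c0_le)
    fix n
    show "\<bar>c0_nth (x + y) n\<bar> \<le> norm x + norm y"
      using abs_c0_nth_le_norm[of x n] abs_c0_nth_le_norm[of y n] by simp
  qed
  have le: "norm (s *\<^sub>R z) \<le> \<bar>s\<bar> * norm z" for s and z :: c0
    by (rule norm_c0_le) (simp add: abs_mult abs_c0_nth_le_norm mult_left_mono)
  show "norm (r *\<^sub>R x) = \<bar>r\<bar> * norm x"
  proof (cases "r = 0")
    case True
    then show ?thesis by (simp add: norm_c0_def)
  next
    case False
    have "norm x \<le> \<bar>inverse r\<bar> * norm (r *\<^sub>R x)"
      using le[of "inverse r" "r *\<^sub>R x"] False by simp
    then have "\<bar>r\<bar> * norm x \<le> norm (r *\<^sub>R x)"
      using False by (simp add: field_simps)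
    then show ?thesis using le[of r x] by simp
  qed
qed

end

instance c0 :: banach
proof
  fix X :: "nat \<Rightarrow> c0"
  assume X: "Cauchy X"
  have "Cauchy (\<lambda>k. c0_nth (X k) n)" for n
  proof (rule metric_CauchyI)
    fix e :: real assume "e > 0"
    then obtain M where M: "\<And>k l. k \<ge> M \<Longrightarrow> l \<ge> M \<Longrightarrow> dist (X k) (X l) < e"
      using metric_CauchyD[OF X] by blast
    have "dist (c0_nth (X k) n) (c0_nth (X l) n) < e" if "k \<ge> M" "l \<ge> M" for k l
      using M[OF that] abs_c0_nth_le_norm[of "X k - X l" n] by (simp add: dist_norm)
    then show "\<exists>M. \<forall>k\<ge>M. \<forall>l\<ge>M. dist (c0_nth (X k) n) (c0_nth (X l) n) < e" by blast
  qed
  then have "convergent (\<lambda>k. c0_nth (X k) n)" for n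
    by (simp add: real_Cauchy_convergent)
  then obtain L where L: "\<And>n. (\<lambda>k. c0_nth (X k) n) \<longlonglongrightarrow> L n"
    unfolding convergent_def by metis
  have unif: "\<exists>M. \<forall>k\<ge>M. \<forall>n. \<bar>c0_nth (X k) n - L n\<bar> \<le> e" if "e > 0" for e
  proof -
    obtain M where M: "\<And>k l. k \<ge> M \<Longrightarrow> l \<ge> M \<Longrightarrow> dist (X k) (X l) < e"
      using metric_CauchyD[OF X \<open>e > 0\<close>] by blast
    have "\<bar>c0_nth (X k) n - L n\<bar> \<le> e" if "k \<ge> M" for k n
    proof (rule LIMSEQ_le_const2)
      show "(\<lambda>l. \<bar>c0_nth (X k) n - c0_nth (X l) n\<bar>) \<longlonglongrightarrow> \<bar>c0_nth (X k) n - L n\<bar>"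
        by (intro tendsto_intros L)
      have "\<bar>c0_nth (X k) n - c0_nth (X l) n\<bar> \<le> e" if "l \<ge> M" for l
        using M[OF \<open>k \<ge> M\<close> that] abs_c0_nth_le_norm[of "X k - X l" n] by (simp add: dist_norm)
      then show "\<exists>N. \<forall>l\<ge>N. \<bar>c0_nth (X k) n - c0_nth (X l) n\<bar> \<le> e" by blast
    qed
    then show ?thesis by blast
  qed
  have "L \<longlonglongrightarrow> 0"
  proof (rule LIMSEQ_I)
    fix e :: real assume "e > 0"
    then obtain k where k: "\<And>n. \<bar>c0_nth (X k) n - L n\<bar> \<le> e / 2"
      using unif[of "e / 2"] by auto
    obtain N where N: "\<And>n. n \<ge> N \<Longrightarrow> \<bar>c0_nth (X k) n\<bar> < e / 2"
      using LIMSEQ_D[OF c0_nth_tendsto_0, of "e / 2" "X k"] \<open>e > 0\<close> by auto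
    have "norm (L n - 0) < e" if "n \<ge> N" for n
      using k[of n] N[OF that] unfolding real_norm_def by linarith
    then show "\<exists>N. \<forall>n\<ge>N. norm (L n - 0) < e" by blast
  qed
  then have nth_L: "c0_nth (Abs_c0 L) = L"
    by (simp add: Abs_c0_inverse)
  have "X \<longlonglongrightarrow> Abs_c0 L"
  proof (rule LIMSEQ_I)
    fix e :: real assume "e > 0"
    then obtain M where M: "\<And>k n. k \<ge> M \<Longrightarrow> \<bar>c0_nth (X k) n - L n\<bar> \<le> e / 2"
      using unif[of "e / 2"] by auto
    have "norm (X k - Abs_c0 L) < e" if "k \<ge> M" for k
    proof -
      have "norm (X k - Abs_c0 L) \<le> e / 2"
        using M[OF that] by (intro norm_c0_le) (simp add: nth_L)
      then show ?thesis using \<open>e > 0\<close> by simp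
    qed
    then show "\<exists>M. \<forall>k\<ge>M. norm (X k - Abs_c0 L) < e" by blast
  qed
  then show "convergent X" by (rule convergentI)
qed

lift_definition c0_basis :: "nat \<Rightarrow> c0" is "\<lambda>j n. if n = j then 1 else 0"
proof -
  fix j :: nat
  have "\<forall>\<^sub>F n in sequentially. (if n = j then 1 else 0) = (0 :: real)"
    using eventually_gt_at_top[of j] by eventually_elim simp
  then show "(\<lambda>n. if n = j then 1 else 0 :: real) \<longlonglongrightarrow> 0"
    by (rule tendsto_eventually)
qed

lemma c0_basis_sums: "(\<lambda>j. c0_nth x j *\<^sub>R c0_basis j) sums x"
  unfolding sums_def
proof (rule LIMSEQ_I)
  fix e :: real assume "e > 0"
  then obtain N where N: "\<And>n. n \<ge> N \<Longrightarrow> \<bar>c0_nth x n\<bar> < e / 2"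
    using LIMSEQ_D[OF c0_nth_tendsto_0, of "e / 2" x] by auto
  have "norm ((\<Sum>j<m. c0_nth x j *\<^sub>R c0_basis j) - x) < e" if "m \<ge> N" for m
  proof -
    have nth: "c0_nth (\<Sum>j<m. c0_nth x j *\<^sub>R c0_basis j) n = (if n < m then c0_nth x n else 0)" for n
      by (simp add: c0_nth_sum c0_basis.rep_eq if_distrib[of "(*) _"] cong: if_cong)
    have "norm ((\<Sum>j<m. c0_nth x j *\<^sub>R c0_basis j) - x) \<le> e / 2"
    proof (rule norm_c0_le)
      fix n
      show "\<bar>c0_nth ((\<Sum>j<m. c0_nth x j *\<^sub>R c0_basis j) - x) n\<bar> \<le> e / 2"
        using N[of n] that \<open>e > 0\<close> by (cases "n < m") (simp_all add: nth)
    qed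
    then show ?thesis using \<open>e > 0\<close> by simp
  qed
  then show "\<exists>N. \<forall>m\<ge>N. norm ((\<Sum>j<m. c0_nth x j *\<^sub>R c0_basis j) - x) < e" by blast
qed

section \<open>Bilinear forms on null sequences\<close>

text \<open>Continuity of a bilinear form is expressed by \<^const>\<open>bounded_bilinear\<close>.\<close>

definition bilinear_form_norm :: "(c0 \<Rightarrow> c0 \<Rightarrow> real) \<Rightarrow> real" where
  "bilinear_form_norm T = Sup {\<bar>T x y\<bar> | x y. norm x \<le> 1 \<and> norm y \<le> 1}"

definition bilinear_form_coeff :: "(c0 \<Rightarrow> c0 \<Rightarrow> real) \<Rightarrow> nat \<Rightarrow> nat \<Rightarrow> real" where
  "bilinear_form_coeff T i j = T (c0_basis i) (c0_basis j)"

lemma bdd_above_bilinear_form_norm: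
  fixes T :: "c0 \<Rightarrow> c0 \<Rightarrow> real"
  assumes "bounded_bilinear T"
  shows "bdd_above {\<bar>T x y\<bar> | x y. norm x \<le> 1 \<and> norm y \<le> 1}"
proof -
  obtain K where K: "K \<ge> 0" "\<And>x y. norm (T x y) \<le> norm x * norm y * K"
    using bounded_bilinear.nonneg_bounded[OF assms] by blast
  have "\<bar>T x y\<bar> \<le> K" if "norm x \<le> 1" "norm y \<le> 1" for x y
  proof -
    have "norm x * norm y \<le> 1"
      using that by (simp add: mult_le_one)
    then have "norm x * norm y * K \<le> 1 * K"
      using K(1) by (rule mult_right_mono)
    then show ?thesis using K(2)[of x y] by simp
  qed
  then show ?thesis by (auto intro!: bdd_aboveI[of _ K])
qed

text \<open>
  The expansion of a bounded bilinear form in its coefficients. The double series need not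
  converge absolutely, so it is summed iteratively.
\<close>

lemma bilinear_form_expansion_inner:
  fixes T :: "c0 \<Rightarrow> c0 \<Rightarrow> real"
  assumes "bounded_bilinear T"
  shows "(\<lambda>j. bilinear_form_coeff T i j * c0_nth x i * c0_nth y j) sums
           (c0_nth x i * T (c0_basis i) y)"
proof -
  have "(\<lambda>j. T (c0_basis i) (c0_nth y j *\<^sub>R c0_basis j)) sums T (c0_basis i) y"
    by (rule bounded_linear.sums[OF bounded_bilinear.bounded_linear_right[OF assms] c0_basis_sums])
  then have "(\<lambda>j. c0_nth x i * T (c0_basis i) (c0_nth y j *\<^sub>R c0_basis j)) sums
               (c0_nth x i * T (c0_basis i) y)"
    by (rule sums_mult)
  then show ?thesis
    by (simp add: bilinear_form_coeff_def bounded_bilinear.scaleR_right[OF assms] mult_ac)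
qed

lemma bilinear_form_expansion:
  fixes T :: "c0 \<Rightarrow> c0 \<Rightarrow> real"
  assumes "bounded_bilinear T"
  shows "(\<lambda>i. \<Sum>j. bilinear_form_coeff T i j * c0_nth x i * c0_nth y j) sums T x y"
proof -
  have "(\<lambda>i. T (c0_nth x i *\<^sub>R c0_basis i) y) sums T x y"
    by (rule bounded_linear.sums[OF bounded_bilinear.bounded_linear_left[OF assms] c0_basis_sums])
  then show ?thesis
    by (simp add: bounded_bilinear.scaleR_left[OF assms]
        sums_unique[OF bilinear_form_expansion_inner[OF assms], symmetric])
qed

text \<open>
  If the family in the following definition is not summable, then \<^const>\<open>infsum\<close> is 0
  and the equation fails, so an extremum has a summable family.
\<close>

definition littlewood_extremum :: "(c0 \<Rightarrow> c0 \<Rightarrow> real) \<Rightarrow> bool" where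
  "littlewood_extremum T \<longleftrightarrow>
     bilinear_form_norm T = 1 \<and>
     (\<Sum>\<^sub>\<infinity>(i, j)\<in>UNIV. \<bar>T (c0_basis i) (c0_basis j)\<bar> powr (4 / 3)) powr (3 / 4) = sqrt 2"

definition S1 :: "(c0 \<Rightarrow> c0 \<Rightarrow> real) \<Rightarrow> nat \<Rightarrow> (nat \<times> nat) set" where
  "S1 T n = {(n, j) | j. bilinear_form_coeff T n j \<noteq> 0}"

definition S2 :: "(c0 \<Rightarrow> c0 \<Rightarrow> real) \<Rightarrow> nat \<Rightarrow> (nat \<times> nat) set" where
  "S2 T n = {(i, n) | i. bilinear_form_coeff T i n \<noteq> 0}"

text \<open>\<^const>\<open>card\<close> is 0 on infinite sets, so cardinalities are taken in \<^typ>\<open>enat\<close>.\<close>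

definition ecard :: "'a set \<Rightarrow> enat" where
  "ecard A = (if finite A then enat (card A) else \<infinity>)"

definition complexity :: "(c0 \<Rightarrow> c0 \<Rightarrow> real) \<Rightarrow> enat" where
  "complexity T = sup (SUP n. ecard (S1 T n)) (SUP n. ecard (S2 T n))"

end

theory Submission
  imports Defs
begin

text \<open>
  Write \<open>r\<^sub>i\<close> and \<open>c\<^sub>j\<close> for the Euclidean norms of the rows and columns of the coefficient matrix.
  Hoelder's and Minkowski's inequalities (\<open>sum_powr_four_thirds_le\<close>) bound the sum of the
  \<open>|a\<^sub>i\<^sub>j|\<close> to the power \<open>4/3\<close> by \<open>(\<Sum>r\<^sub>i)\<close> to the power \<open>2/3\<close> times \<open>(\<Sum>c\<^sub>j)\<close> to the power \<open>2/3\<close>.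
  Khinchine's inequality with its optimal constant says that \<open>r\<^sub>i\<close> is at most \<open>sqrt 2\<close> times the
  average of \<open>|\<Sum>\<^sub>j \<epsilon>\<^sub>j a\<^sub>i\<^sub>j|\<close> over all signs; summed over the rows, these averages are at most
  the norm of the form, because for each choice of the \<open>\<epsilon>\<^sub>j\<close> the absolute values
  can be absorbed into signs on the rows. So both sums of norms are at most \<open>sqrt 2\<close>, which gives
  Littlewood's inequality, and an extremum
  must have equality in Khinchine's inequality for every row and for every column
  (\<open>row_khinchine_extremal\<close>). The statement is then the equality case of Khinchine's inequality: a nonzero
  coefficient sequence attaining equality has exactly two nonzero entries, of equal modulus
  (\<open>two_equal_coefficients\<close>).

  The optimal Khinchine inequality is proved by the method of Latala and Oleszkiewicz. Let \<open>f\<close> be the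
  absolute value of the sum \<open>S\<close> of the \<open>\<epsilon>\<^sub>j a\<^sub>j\<close>, a function on the cube of signs, and let \<open>L f\<close> be
  the sum over \<open>j\<close> of \<open>(f - f \<circ> flip j) / 2\<close>, the number operator on Walsh functions.
  As \<open>f\<close> is even, its Walsh expansion has no odd degrees, so the average of \<open>f * L f\<close>
  is at least twice the variance of \<open>f\<close>; by the triangle inequality, \<open>L f \<le> f\<close>. Hence
  \<open>2 * (avg f)\<^sup>2 \<ge> \<Sum>\<^sub>j a\<^sub>j\<^sup>2\<close>.

  For the equality case both losses are kept, in \<open>khinchine_deficit\<close>. The loss in \<open>L f \<le> f\<close>
  is, after multiplication by \<open>f\<close>, exactly the sum over \<open>j\<close> of
  the positive parts of \<open>a\<^sub>j\<^sup>2 - (S - \<epsilon>\<^sub>j a\<^sub>j)\<^sup>2\<close>; the loss in the spectral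
  gap controls all Walsh coefficients of degree at least four. In an absolutely summable sequence with
  equality, the first loss forces that no \<open>|a\<^sub>j|\<close> exceeds
  the modulus of a signed sum of all the other coefficients. A greedy choice of signs violates this
  unless all nonzero \<open>|a\<^sub>j|\<close> are equal, and a balanced choice violates it if their number is odd.
  The second loss excludes an even number of at least four: at a point where \<open>S\<close> vanishes and four of the
  terms have signs \<open>+,+,-,-\<close>, the fourth mixed difference of \<open>f\<close> is nonzero.
\<close>

section \<open>Walsh analysis on the cube of signs\<close>

text \<open>
  Points of the cube of signs on \<open>I\<close> are subsets of \<open>I\<close>: the set \<open>A\<close> stands for
  the sign vector \<open>rad A\<close> that is negative exactly on \<open>A\<close>.
\<close>

definition rad :: "'a set \<Rightarrow> 'a \<Rightarrow> real" where
  "rad A j = (if j \<in> A then -1 else 1)"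

definition flip :: "'a \<Rightarrow> 'a set \<Rightarrow> 'a set" where
  "flip j A = (if j \<in> A then A - {j} else insert j A)"

definition cube_avg :: "'a set \<Rightarrow> ('a set \<Rightarrow> real) \<Rightarrow> real" where
  "cube_avg I f = (\<Sum>A\<in>Pow I. f A) / 2 ^ card I"

definition walsh :: "'a set \<Rightarrow> 'a set \<Rightarrow> real" where
  "walsh S A = (\<Prod>j\<in>S. rad A j)"

definition fourier :: "'a set \<Rightarrow> ('a set \<Rightarrow> real) \<Rightarrow> 'a set \<Rightarrow> real" where
  "fourier I f S = cube_avg I (\<lambda>A. f A * walsh S A)"

definition flip_diff :: "'a \<Rightarrow> ('a set \<Rightarrow> real) \<Rightarrow> 'a set \<Rightarrow> real" where
  "flip_diff j f A = (f A - f (flip j A)) / 2"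

lemma rad_sq [simp]: "rad A j * rad A j = 1" and rad_power2 [simp]: "(rad A j)\<^sup>2 = 1"
  and abs_rad [simp]: "\<bar>rad A j\<bar> = 1"
  by (auto simp: rad_def)

lemma rad_flip: "rad (flip j A) i = (if i = j then - rad A i else rad A i)"
  by (cases "j \<in> A"; cases "i = j"; simp add: rad_def flip_def)

lemma flip_flip [simp]: "flip j (flip j A) = A"
  by (auto simp: flip_def)

lemma flip_subset: "j \<in> I \<Longrightarrow> A \<subseteq> I \<Longrightarrow> flip j A \<subseteq> I"
  by (auto simp: flip_def)

lemma cube_avg_cong: "(\<And>A. A \<subseteq> I \<Longrightarrow> f A = g A) \<Longrightarrow> cube_avg I f = cube_avg I g"
  unfolding cube_avg_def by (auto intro!: sum.cong arg_cong[of _ _ "\<lambda>x. x / _"])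

lemma cube_avg_diff: "cube_avg I (\<lambda>A. f A - g A) = cube_avg I f - cube_avg I g"
  by (simp add: cube_avg_def sum_subtractf diff_divide_distrib)

lemma cube_avg_cmult: "cube_avg I (\<lambda>A. c * f A) = c * cube_avg I f"
  by (simp add: cube_avg_def sum_distrib_left)

lemma cube_avg_sum: "cube_avg I (\<lambda>A. \<Sum>k\<in>K. f k A) = (\<Sum>k\<in>K. cube_avg I (f k))"
  by (simp add: cube_avg_def sum.swap[of _ _ K] sum_divide_distrib)

lemma cube_avg_const: "finite I \<Longrightarrow> cube_avg I (\<lambda>A. c) = c"
  by (simp add: cube_avg_def card_Pow)

lemma cube_avg_mono: "(\<And>A. A \<subseteq> I \<Longrightarrow> f A \<le> g A) \<Longrightarrow> cube_avg I f \<le> cube_avg I g"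
  unfolding cube_avg_def by (intro divide_right_mono sum_mono) auto

lemma cube_avg_nonneg: "(\<And>A. A \<subseteq> I \<Longrightarrow> 0 \<le> f A) \<Longrightarrow> 0 \<le> cube_avg I f"
  unfolding cube_avg_def by (intro divide_nonneg_nonneg sum_nonneg) auto

lemma cube_avg_flip:
  assumes "j \<in> I"
  shows "cube_avg I (\<lambda>A. f (flip j A)) = cube_avg I f"
proof -
  have "(\<Sum>A\<in>Pow I. f (flip j A)) = (\<Sum>A\<in>Pow I. f A)"
    by (rule sum.reindex_bij_witness[of _ "flip j" "flip j"]) (simp_all add: assms flip_subset)
  then show ?thesis by (simp add: cube_avg_def)
qed

lemma cube_avg_compl: "cube_avg I (\<lambda>A. f (I - A)) = cube_avg I f"
proof -
  have "(\<Sum>A\<in>Pow I. f (I - A)) = (\<Sum>A\<in>Pow I. f A)"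
    by (rule sum.reindex_bij_witness[of _ "\<lambda>A. I - A" "\<lambda>A. I - A"]) auto
  then show ?thesis by (simp add: cube_avg_def)
qed

text \<open>
  Summation over the frequency turns the sum into a product over \<open>I\<close> that contains a factor
  \<open>0\<close> at every coordinate on which the two sign vectors differ.
\<close>

lemma walsh_orthogonal:
  assumes "finite I" "A \<subseteq> I" "B \<subseteq> I"
  shows "(\<Sum>S\<in>Pow I. walsh S A * walsh S B) = (if A = B then 2 ^ card I else 0)"
proof -
  have "(\<Sum>S\<in>Pow I. walsh S A * walsh S B) = (\<Prod>j\<in>I. rad A j * rad B j + 1)"
    unfolding prod_add[OF assms(1)] walsh_def by (simp add: prod.distrib)
  also have "\<dots> = (if A = B then 2 ^ card I else 0)"
  proof (cases "A = B")
    case False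
    then obtain j where j: "j \<in> I" "j \<in> A \<longleftrightarrow> j \<notin> B"
      using assms by blast
    then have "rad A j * rad B j + 1 = 0"
      by (auto simp: rad_def)
    then have "(\<Prod>j\<in>I. rad A j * rad B j + 1) = 0"
      using j(1) assms(1) by (intro prod_zero) auto
    then show ?thesis using False by simp
  qed simp
  finally show ?thesis .
qed

lemma parseval:
  assumes "finite I"
  shows "(\<Sum>S\<in>Pow I. (fourier I f S)\<^sup>2) = cube_avg I (\<lambda>A. (f A)\<^sup>2)"
proof -
  have fin: "finite (Pow I)" using assms by simp
  have "(\<Sum>S\<in>Pow I. (\<Sum>A\<in>Pow I. f A * walsh S A)\<^sup>2) =
        (\<Sum>S\<in>Pow I. \<Sum>A\<in>Pow I. \<Sum>B\<in>Pow I. f A * f B * (walsh S A * walsh S B))"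
    by (simp add: power2_eq_square sum_product algebra_simps)
  also have "\<dots> = (\<Sum>A\<in>Pow I. \<Sum>B\<in>Pow I. f A * f B * (\<Sum>S\<in>Pow I. walsh S A * walsh S B))"
    unfolding sum_distrib_left
    by (subst sum.swap, rule sum.cong[OF refl], subst sum.swap, rule refl)
  also have "\<dots> = (\<Sum>A\<in>Pow I. \<Sum>B\<in>Pow I. if B = A then (f A)\<^sup>2 * 2 ^ card I else 0)"
    using assms by (intro sum.cong refl) (auto simp: walsh_orthogonal power2_eq_square)
  also have "\<dots> = (\<Sum>A\<in>Pow I. (f A)\<^sup>2) * 2 ^ card I"
    using fin by (simp add: sum_distrib_right)
  finally show ?thesis
    by (simp add: fourier_def cube_avg_def power_divide sum_divide_distrib[symmetric] power2_eq_square)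
qed

text \<open>
  Each flip difference is the projection onto the frequencies that contain \<open>j\<close>. Both the
  energy identity and the control of fourth mixed differences rest on this.
\<close>

lemma fourier_flip_diff:
  assumes "finite I" "j \<in> I" "S \<subseteq> I"
  shows "fourier I (flip_diff j f) S = (if j \<in> S then fourier I f S else 0)"
proof -
  have walsh_flip: "walsh S (flip j A) = (if j \<in> S then - walsh S A else walsh S A)" for A
  proof (cases "j \<in> S")
    case True
    then show ?thesis
      using finite_subset[OF assms(3,1)] by (simp add: walsh_def prod.remove rad_flip)
  qed (auto simp: walsh_def rad_flip intro!: prod.cong)
  have "cube_avg I (\<lambda>A. f (flip j A) * walsh S A)
      = cube_avg I (\<lambda>A. f A * walsh S (flip j A))"
    using cube_avg_flip[OF assms(2), of "\<lambda>A. f A * walsh S (flip j A)"] by simp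
  also have "\<dots> = (if j \<in> S then - fourier I f S else fourier I f S)"
    using cube_avg_cmult[of I "-1"] by (simp add: walsh_flip fourier_def)
  finally have shifted: "cube_avg I (\<lambda>A. f (flip j A) * walsh S A)
    = (if j \<in> S then - fourier I f S else fourier I f S)" .
  have "fourier I (flip_diff j f) S =
      cube_avg I (\<lambda>A. 1/2 * (f A * walsh S A - f (flip j A) * walsh S A))"
    unfolding fourier_def by (rule cube_avg_cong) (simp add: flip_diff_def field_simps)
  also have "\<dots> = 1/2 * (fourier I f S - cube_avg I (\<lambda>A. f (flip j A) * walsh S A))"
    unfolding cube_avg_cmult cube_avg_diff fourier_def ..
  finally show ?thesis using shifted by (cases "j \<in> S") simp_all
qed

lemma fourier_even:
  assumes "finite I" "S \<subseteq> I" "odd (card S)" and even_f: "\<And>A. A \<subseteq> I \<Longrightarrow> f (I - A) = f A"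
  shows "fourier I f S = 0"
proof -
  have walsh_compl: "walsh S (I - A) = - walsh S A" for A
  proof -
    have "walsh S (I - A) = (\<Prod>j\<in>S. - rad A j)"
      unfolding walsh_def using assms(2) by (intro prod.cong) (auto simp: rad_def)
    then show ?thesis using assms(3) by (simp add: prod_uminus walsh_def)
  qed
  have "fourier I f S = cube_avg I (\<lambda>A. f (I - A) * walsh S (I - A))"
    unfolding fourier_def by (rule cube_avg_compl[symmetric])
  also have "\<dots> = cube_avg I (\<lambda>A. - 1 * (f A * walsh S A))"
    by (rule cube_avg_cong) (simp add: walsh_compl even_f)
  also have "\<dots> = - fourier I f S"
    unfolding cube_avg_cmult fourier_def by simp
  finally show ?thesis by simp
qed

text \<open>
  The left-hand side is the quadratic form of the number operator, whose eigenvalue on the Walsh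
  function of \<open>S\<close> is \<open>card S\<close>.
\<close>

lemma energy_fourier:
  assumes "finite I"
  shows "(\<Sum>j\<in>I. cube_avg I (\<lambda>A. (flip_diff j f A)\<^sup>2))
    = (\<Sum>S\<in>Pow I. real (card S) * (fourier I f S)\<^sup>2)"
proof -
  have "(\<Sum>j\<in>I. cube_avg I (\<lambda>A. (flip_diff j f A)\<^sup>2))
      = (\<Sum>j\<in>I. \<Sum>S\<in>Pow I. if j \<in> S then (fourier I f S)\<^sup>2 else 0)"
    unfolding parseval[OF assms, symmetric]
    using assms by (intro sum.cong refl) (auto simp: fourier_flip_diff)
  also have "\<dots> = (\<Sum>S\<in>Pow I. \<Sum>j\<in>I. if j \<in> S then (fourier I f S)\<^sup>2 else 0)"
    by (rule sum.swap)
  also have "\<dots> = (\<Sum>S\<in>Pow I. real (card S) * (fourier I f S)\<^sup>2)"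
  proof (intro sum.cong refl)
    fix S assume "S \<in> Pow I"
    then have "I \<inter> S = S" by auto
    then show "(\<Sum>j\<in>I. if j \<in> S then (fourier I f S)\<^sup>2 else 0) = real (card S) * (fourier I f S)\<^sup>2"
      using assms by (simp add: sum.inter_restrict[symmetric])
  qed
  finally show ?thesis .
qed

text \<open>
  An even function has only even frequencies, so after the constant the first eigenvalue of the
  number operator is \<open>2\<close>. Frequencies of degree two contribute equally to both sides; those
  of degree \<open>d \<ge> 4\<close> leave the surplus \<open>d - 2 \<ge> 2\<close>.
\<close>

lemma spectral_gap_even:
  assumes "finite I" and even_f: "\<And>A. A \<subseteq> I \<Longrightarrow> f (I - A) = f A"
  shows "2 * (\<Sum>S\<in>{S\<in>Pow I. 4 \<le> card S}. (fourier I f S)\<^sup>2)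
     \<le> (\<Sum>j\<in>I. cube_avg I (\<lambda>A. (flip_diff j f A)\<^sup>2))
        - 2 * (cube_avg I (\<lambda>A. (f A)\<^sup>2) - (cube_avg I f)\<^sup>2)"
proof -
  have fin: "finite (Pow I)" using assms by simp
  have mean: "cube_avg I f = fourier I f {}"
    by (simp add: fourier_def walsh_def)
  have point: "(if 4 \<le> card S then 2 * (fourier I f S)\<^sup>2 else 0)
      \<le> real (card S) * (fourier I f S)\<^sup>2 - 2 * (fourier I f S)\<^sup>2
        + (if S = {} then 2 * (fourier I f {})\<^sup>2 else 0)" if S: "S \<in> Pow I" for S
  proof -
    have finS: "finite S" using S assms(1) finite_subset by auto
    consider "S = {}" | "S \<noteq> {}" "card S < 4" "odd (card S)" | "card S = 2" | "4 \<le> card S"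
    proof -
      have "card S = 0 \<or> odd (card S) \<or> card S = 2 \<or> 4 \<le> card S" by presburger
      then show ?thesis using that finS
        by (metis card_0_eq linorder_not_less)
    qed
    then show ?thesis
    proof cases
      case 2
      then have "fourier I f S = 0"
        using S by (intro fourier_even assms) auto
      then show ?thesis using 2 by simp
    next
      case 4
      have "4 * (fourier I f S)\<^sup>2 \<le> real (card S) * (fourier I f S)\<^sup>2"
        using 4 by (intro mult_right_mono) auto
      then show ?thesis using 4 by auto
    qed auto
  qed
  have "2 * (\<Sum>S\<in>{S\<in>Pow I. 4 \<le> card S}. (fourier I f S)\<^sup>2)
      = (\<Sum>S\<in>Pow I. if 4 \<le> card S then 2 * (fourier I f S)\<^sup>2 else 0)"
    unfolding sum.inter_filter[OF fin] sum_distrib_left by (intro sum.cong) auto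
  also have "\<dots> \<le> (\<Sum>S\<in>Pow I. real (card S) * (fourier I f S)\<^sup>2 - 2 * (fourier I f S)\<^sup>2
        + (if S = {} then 2 * (fourier I f {})\<^sup>2 else 0))"
    by (rule sum_mono) (rule point)
  also have "\<dots> = (\<Sum>S\<in>Pow I. real (card S) * (fourier I f S)\<^sup>2)
      - 2 * (\<Sum>S\<in>Pow I. (fourier I f S)\<^sup>2) + 2 * (fourier I f {})\<^sup>2"
    using fin by (simp add: sum.distrib sum_subtractf sum_distrib_left)
  finally show ?thesis
    by (simp add: energy_fourier[OF assms(1)] parseval[OF assms(1)] mean)
qed

text \<open>
  The fourth mixed difference keeps only frequencies that contain all four coordinates. It gives
  a pointwise way to detect the surplus in the spectral gap.
\<close>

lemma flip_diff4_le:
  assumes "finite I" "{i, j, k, l} \<subseteq> I" "distinct [i, j, k, l]"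
  shows "cube_avg I (\<lambda>A. (flip_diff i (flip_diff j (flip_diff k (flip_diff l f))) A)\<^sup>2)
     \<le> (\<Sum>S\<in>{S\<in>Pow I. 4 \<le> card S}. (fourier I f S)\<^sup>2)"
proof -
  have fin: "finite (Pow I)" using assms by simp
  have card4: "4 \<le> card S" if "{i, j, k, l} \<subseteq> S" "S \<subseteq> I" for S
    using card_mono[OF finite_subset[OF that(2) assms(1)] that(1)] assms(3) by simp
  have "cube_avg I (\<lambda>A. (flip_diff i (flip_diff j (flip_diff k (flip_diff l f))) A)\<^sup>2)
      = (\<Sum>S\<in>Pow I. if {i, j, k, l} \<subseteq> S then (fourier I f S)\<^sup>2 else 0)"
    unfolding parseval[OF assms(1), symmetric]
  proof (intro sum.cong refl)
    fix S assume "S \<in> Pow I"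
    then have "fourier I (flip_diff i (flip_diff j (flip_diff k (flip_diff l f)))) S
        = (if {i, j, k, l} \<subseteq> S then fourier I f S else 0)"
      using assms(1,2) by (simp add: fourier_flip_diff)
    then show "(fourier I (flip_diff i (flip_diff j (flip_diff k (flip_diff l f)))) S)\<^sup>2
        = (if {i, j, k, l} \<subseteq> S then (fourier I f S)\<^sup>2 else 0)"
      by (simp only: if_distrib[of "\<lambda>x. x\<^sup>2"] zero_power2)
  qed
  also have "\<dots> \<le> (\<Sum>S\<in>Pow I. if 4 \<le> card S then (fourier I f S)\<^sup>2 else 0)"
  proof (intro sum_mono)
    fix S assume "S \<in> Pow I"
    then have "{i, j, k, l} \<subseteq> S \<Longrightarrow> 4 \<le> card S" using card4 by blast
    then show "(if {i, j, k, l} \<subseteq> S then (fourier I f S)\<^sup>2 else 0)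
        \<le> (if 4 \<le> card S then (fourier I f S)\<^sup>2 else 0)"
      by (simp del: insert_subset)
  qed
  finally show ?thesis
    unfolding sum.inter_filter[OF fin] .
qed

section \<open>Khinchine's inequality and its deficit\<close>

definition rad_sum :: "'a set \<Rightarrow> ('a \<Rightarrow> real) \<Rightarrow> 'a set \<Rightarrow> real" where
  "rad_sum I a A = (\<Sum>j\<in>I. a j * rad A j)"

lemma rad_sum_remove:
  "finite I \<Longrightarrow> i \<in> I \<Longrightarrow> rad_sum I a A = a i * rad A i + rad_sum (I - {i}) a A"
  by (simp add: rad_sum_def sum.remove)

lemma rad_sum_flip:
  assumes "finite I" "i \<in> I"
  shows "rad_sum I a (flip i A) = rad_sum I a A - 2 * (a i * rad A i)"
proof -
  have "rad_sum (I - {i}) a (flip i A) = rad_sum (I - {i}) a A"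
    unfolding rad_sum_def by (intro sum.cong) (auto simp: rad_flip)
  then show ?thesis
    using rad_sum_remove[OF assms, of a A] rad_sum_remove[OF assms, of a "flip i A"]
    by (simp add: rad_flip)
qed

lemma rad_sum_compl: "rad_sum I a (I - A) = - rad_sum I a A"
  unfolding rad_sum_def sum_negf[symmetric] by (intro sum.cong) (auto simp: rad_def)

lemma rad_sum_Un:
  assumes "finite F" "finite G" "F \<inter> G = {}" "A \<subseteq> F" "B \<subseteq> G"
  shows "rad_sum (F \<union> G) a (A \<union> B) = rad_sum F a A + rad_sum G a B"
proof -
  have "rad_sum F a (A \<union> B) = rad_sum F a A" "rad_sum G a (A \<union> B) = rad_sum G a B"
    unfolding rad_sum_def using assms(3-5) by (intro sum.cong; auto simp: rad_def)+
  then show ?thesis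
    by (simp add: rad_sum_def sum.union_disjoint[OF assms(1-3)])
qed

lemma cube_avg_rad_mult:
  assumes "finite I" "i \<in> I"
  shows "cube_avg I (\<lambda>A. rad A i * rad A j) = (if i = j then 1 else 0)"
proof (cases "i = j")
  case False
  have "cube_avg I (\<lambda>A. rad A i * rad A j) = cube_avg I (\<lambda>A. rad (flip i A) i * rad (flip i A) j)"
    by (rule cube_avg_flip[OF assms(2), symmetric])
  also have "\<dots> = - cube_avg I (\<lambda>A. rad A i * rad A j)"
    using False cube_avg_cmult[of I "-1"] by (simp add: rad_flip)
  finally show ?thesis using False by simp
qed (simp add: cube_avg_const assms)

lemma cube_avg_rad_sum_sq:
  assumes "finite I"
  shows "cube_avg I (\<lambda>A. (rad_sum I a A)\<^sup>2) = (\<Sum>j\<in>I. (a j)\<^sup>2)"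
proof -
  have "cube_avg I (\<lambda>A. (rad_sum I a A)\<^sup>2)
      = cube_avg I (\<lambda>A. \<Sum>i\<in>I. \<Sum>j\<in>I. (a i * a j) * (rad A i * rad A j))"
    by (simp add: rad_sum_def power2_eq_square sum_product algebra_simps)
  also have "\<dots> = (\<Sum>i\<in>I. \<Sum>j\<in>I. (a i * a j) * (if i = j then 1 else 0))"
    unfolding cube_avg_sum cube_avg_cmult using assms
    by (intro sum.cong refl) (simp add: cube_avg_rad_mult)
  also have "\<dots> = (\<Sum>j\<in>I. (a j)\<^sup>2)"
    using assms by (simp add: if_distrib[of "(*) _"] power2_eq_square cong: if_cong)
  finally show ?thesis .
qed

text \<open>
  A flip difference changes sign under its flip, so it is orthogonal to the part of \<open>f\<close> that is
  invariant under this flip.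
\<close>

lemma cube_avg_flip_diff_sq:
  assumes "j \<in> I"
  shows "cube_avg I (\<lambda>A. (flip_diff j f A)\<^sup>2) = cube_avg I (\<lambda>A. f A * flip_diff j f A)"
proof -
  have "cube_avg I (\<lambda>A. f A * flip_diff j f A)
      = cube_avg I (\<lambda>A. f (flip j A) * flip_diff j f (flip j A))"
    by (rule cube_avg_flip[OF assms, symmetric])
  also have "\<dots> = cube_avg I (\<lambda>A. (-1) * (f (flip j A) * flip_diff j f A))"
    by (rule cube_avg_cong) (simp add: flip_diff_def field_simps)
  finally have antisym: "cube_avg I (\<lambda>A. f (flip j A) * flip_diff j f A)
      = - cube_avg I (\<lambda>A. f A * flip_diff j f A)"
    unfolding cube_avg_cmult by simp
  have "cube_avg I (\<lambda>A. (flip_diff j f A)\<^sup>2)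
      = cube_avg I (\<lambda>A. 1/2 * (f A * flip_diff j f A - f (flip j A) * flip_diff j f A))"
    by (rule cube_avg_cong) (simp add: flip_diff_def power2_eq_square field_simps)
  then show ?thesis
    unfolding cube_avg_cmult cube_avg_diff antisym by simp
qed

text \<open>
  With \<open>u\<close> one signed term and \<open>r\<close> the sum of the others, this computes the contribution of one
  coordinate to \<open>f * (f - L f)\<close>: the triangle inequality is strict for the flip
  of that term exactly if \<open>\<bar>r\<bar> < \<bar>u\<bar>\<close>.
\<close>

lemma abs_flip_term:
  fixes u r :: real
  shows "(u + r) * u - \<bar>u + r\<bar> * (\<bar>u + r\<bar> - \<bar>r - u\<bar>) / 2 = max 0 (u\<^sup>2 - r\<^sup>2)"
proof -
  have "\<bar>u + r\<bar> * \<bar>u + r\<bar> = (u + r)\<^sup>2" "\<bar>u + r\<bar> * \<bar>r - u\<bar> = \<bar>r\<^sup>2 - u\<^sup>2\<bar>"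
    by (auto simp: power2_eq_square abs_mult[symmetric] algebra_simps)
  then have "(u + r) * u - \<bar>u + r\<bar> * (\<bar>u + r\<bar> - \<bar>r - u\<bar>) / 2
      = (u + r) * u - ((u + r)\<^sup>2 - \<bar>r\<^sup>2 - u\<^sup>2\<bar>) / 2"
    by (simp add: right_diff_distrib)
  also have "\<dots> = max 0 (u\<^sup>2 - r\<^sup>2)"
    by (simp add: max_def abs_if power2_eq_square field_simps)
  finally show ?thesis .
qed

text \<open>
  The right-hand side is the deficit in Khinchine's inequality. The first sum on the left is what
  the triangle inequality loses; the second bounds from below what the spectral gap loses.
\<close>

theorem khinchine_deficit:
  assumes "finite I"
  shows "(\<Sum>j\<in>I. cube_avg I (\<lambda>A. max 0 ((a j)\<^sup>2 - (rad_sum (I - {j}) a A)\<^sup>2)))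
      + 2 * (\<Sum>S\<in>{S\<in>Pow I. 4 \<le> card S}. (fourier I (\<lambda>A. \<bar>rad_sum I a A\<bar>) S)\<^sup>2)
      \<le> 2 * (cube_avg I (\<lambda>A. \<bar>rad_sum I a A\<bar>))\<^sup>2 - (\<Sum>j\<in>I. (a j)\<^sup>2)"
proof -
  define f where "f = (\<lambda>A. \<bar>rad_sum I a A\<bar>)"
  have pointwise: "(f A)\<^sup>2 - (\<Sum>j\<in>I. f A * flip_diff j f A)
      = (\<Sum>j\<in>I. max 0 ((a j)\<^sup>2 - (rad_sum (I - {j}) a A)\<^sup>2))" for A
  proof -
    have "max 0 ((a j)\<^sup>2 - (rad_sum (I - {j}) a A)\<^sup>2)
        = rad_sum I a A * (a j * rad A j) - f A * flip_diff j f A" if "j \<in> I" for j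
    proof -
      have "rad_sum I a (flip j A) = rad_sum (I - {j}) a A - a j * rad A j"
        using rad_sum_flip[OF assms that] rad_sum_remove[OF assms that] by simp
      then show ?thesis
        using abs_flip_term[of "a j * rad A j" "rad_sum (I - {j}) a A"]
        by (simp add: f_def flip_diff_def rad_sum_remove[OF assms that] power_mult_distrib)
    qed
    then have "(\<Sum>j\<in>I. max 0 ((a j)\<^sup>2 - (rad_sum (I - {j}) a A)\<^sup>2))
        = rad_sum I a A * rad_sum I a A - (\<Sum>j\<in>I. f A * flip_diff j f A)"
      by (simp add: sum_subtractf sum_distrib_left[symmetric] rad_sum_def[symmetric])
    then show ?thesis by (simp add: f_def power2_eq_square)
  qed
  have "(\<Sum>j\<in>I. cube_avg I (\<lambda>A. max 0 ((a j)\<^sup>2 - (rad_sum (I - {j}) a A)\<^sup>2)))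
      = cube_avg I (\<lambda>A. (f A)\<^sup>2) - (\<Sum>j\<in>I. cube_avg I (\<lambda>A. (flip_diff j f A)\<^sup>2))"
    unfolding cube_avg_sum[symmetric] pointwise[symmetric] cube_avg_diff
    by (simp add: cube_avg_sum cube_avg_flip_diff_sq)
  moreover have "2 * (\<Sum>S\<in>{S\<in>Pow I. 4 \<le> card S}. (fourier I f S)\<^sup>2)
     \<le> (\<Sum>j\<in>I. cube_avg I (\<lambda>A. (flip_diff j f A)\<^sup>2))
        - 2 * (cube_avg I (\<lambda>A. (f A)\<^sup>2) - (cube_avg I f)\<^sup>2)"
    by (rule spectral_gap_even[OF assms]) (simp add: f_def rad_sum_compl)
  moreover have "cube_avg I (\<lambda>A. (f A)\<^sup>2) = (\<Sum>j\<in>I. (a j)\<^sup>2)"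
    using cube_avg_rad_sum_sq[OF assms] by (simp add: f_def)
  ultimately show ?thesis by (simp add: f_def)
qed

corollary khinchine:
  assumes "finite I"
  shows "L2_set a I \<le> sqrt 2 * cube_avg I (\<lambda>A. \<bar>rad_sum I a A\<bar>)"
proof -
  have "0 \<le> (\<Sum>j\<in>I. cube_avg I (\<lambda>A. max 0 ((a j)\<^sup>2 - (rad_sum (I - {j}) a A)\<^sup>2)))"
    by (intro sum_nonneg cube_avg_nonneg) simp
  moreover have "0 \<le> (\<Sum>S\<in>{S\<in>Pow I. 4 \<le> card S}. (fourier I (\<lambda>A. \<bar>rad_sum I a A\<bar>) S)\<^sup>2)"
    by (intro sum_nonneg) simp
  ultimately have "(\<Sum>j\<in>I. (a j)\<^sup>2) \<le> (sqrt 2 * cube_avg I (\<lambda>A. \<bar>rad_sum I a A\<bar>))\<^sup>2"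
    using khinchine_deficit[OF assms, of a] by (simp add: power_mult_distrib)
  then show ?thesis
    unfolding L2_set_def by (intro real_le_lsqrt) (auto intro!: mult_nonneg_nonneg cube_avg_nonneg)
qed

text \<open>
  The terms of the mixed difference are the values of \<open>f\<close> after flipping a subset of the four
  coordinates: four singletons and four triples give \<open>2 * V\<close> each, two of the pairs give
  \<open>4 * V\<close>, and all others vanish. Hence the value \<open>(- 16 + 8) * V / 16\<close>.
\<close>

lemma flip_diff4_balanced:
  assumes "finite I" "{i, j, k, l} \<subseteq> I" "distinct [i, j, k, l]" "0 \<le> V"
    and "rad_sum I a A = 0"
    and "a i * rad A i = V" "a j * rad A j = V" "a k * rad A k = - V" "a l * rad A l = - V"
  shows "flip_diff i (flip_diff j (flip_diff k (flip_diff l (\<lambda>A. \<bar>rad_sum I a A\<bar>)))) A = - V / 2"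
proof -
  have "i \<noteq> j" "j \<noteq> i" "i \<noteq> k" "k \<noteq> i" "i \<noteq> l" "l \<noteq> i"
    "j \<noteq> k" "k \<noteq> j" "j \<noteq> l" "l \<noteq> j" "k \<noteq> l" "l \<noteq> k"
    using assms(3) by auto
  then show ?thesis
    using assms(1,2,4-) by (simp add: flip_diff_def rad_sum_flip rad_flip)
qed

text \<open>
  A pointwise bound on a cylinder gives a bound on averages that does not depend on the number of
  further coordinates; so a defect seen in finitely many coordinates persists in the limit.
\<close>

lemma cube_avg_cylinder:
  assumes "finite J" "I \<subseteq> J" "A \<subseteq> I"
    and "\<And>B. B \<subseteq> J \<Longrightarrow> 0 \<le> g B" and "\<And>C. C \<subseteq> J - I \<Longrightarrow> \<delta> \<le> g (A \<union> C)"
  shows "\<delta> / 2 ^ card I \<le> cube_avg J g"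
proof -
  have inj: "inj_on (\<lambda>C. A \<union> C) (Pow (J - I))"
    using assms(3) by (intro inj_onI) blast
  have "real (card (Pow (J - I))) * \<delta> \<le> (\<Sum>C\<in>Pow (J - I). g (A \<union> C))"
    using assms(5) by (intro sum_bounded_below) auto
  also have "\<dots> = (\<Sum>B\<in>(\<lambda>C. A \<union> C) ` Pow (J - I). g B)"
    by (simp add: sum.reindex[OF inj])
  also have "\<dots> \<le> (\<Sum>B\<in>Pow J. g B)"
    using assms(1-4) by (intro sum_mono2) auto
  finally have "2 ^ (card J - card I) * \<delta> \<le> (\<Sum>B\<in>Pow J. g B)"
    using assms(1,2) by (simp add: card_Pow card_Diff_subset finite_subset)
  moreover have "2 ^ card J = (2 ^ (card J - card I) * 2 ^ card I :: real)"
    using card_mono[OF assms(1,2)] by (simp add: power_add[symmetric])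
  ultimately show ?thesis
    unfolding cube_avg_def by (simp add: field_simps)
qed

text \<open>
  Averaging over one additional sign cannot decrease the average, by
  \<open>2 * \<bar>s\<bar> \<le> \<bar>s + b\<bar> + \<bar>s - b\<bar>\<close>.
\<close>

lemma cube_avg_abs_rad_sum_mono:
  assumes "finite J" "I \<subseteq> J"
  shows "cube_avg I (\<lambda>A. \<bar>rad_sum I a A\<bar>) \<le> cube_avg J (\<lambda>A. \<bar>rad_sum J a A\<bar>)"
proof -
  have "cube_avg I (\<lambda>A. \<bar>rad_sum I a A\<bar>) \<le> cube_avg (I \<union> K) (\<lambda>A. \<bar>rad_sum (I \<union> K) a A\<bar>)"
    if "finite K" "I \<inter> K = {}" for K
    using that
  proof (induction K rule: finite_induct)
    case (insert x K)
    define L where "L = I \<union> K"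
    have L: "finite L" "x \<notin> L" "I \<union> insert x K = insert x L"
      using insert assms finite_subset unfolding L_def by auto
    have Pow_eq: "Pow (insert x L) = Pow L \<union> insert x ` Pow L"
      by (rule Pow_insert)
    have inj: "inj_on (insert x) (Pow L)"
      using L(2) by (intro inj_onI) (metis PowD insert_ident subsetD)
    have notin: "rad_sum (insert x L) a A = a x + rad_sum L a A"
      and ins: "rad_sum (insert x L) a (insert x A) = - a x + rad_sum L a A" if "A \<subseteq> L" for A
    proof -
      have "rad_sum L a (insert x A) = rad_sum L a A"
        unfolding rad_sum_def using L(2) by (intro sum.cong) (auto simp: rad_def)
      moreover have "x \<notin> A" using that L(2) by auto
      ultimately show "rad_sum (insert x L) a A = a x + rad_sum L a A"
         "rad_sum (insert x L) a (insert x A) = - a x + rad_sum L a A"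
        using L(1,2) by (simp_all add: rad_sum_def) (simp_all add: rad_def)
    qed
    have "2 * (\<Sum>A\<in>Pow L. \<bar>rad_sum L a A\<bar>)
        \<le> (\<Sum>A\<in>Pow L. \<bar>a x + rad_sum L a A\<bar> + \<bar>- a x + rad_sum L a A\<bar>)"
      unfolding sum_distrib_left by (intro sum_mono) linarith
    also have "\<dots> = (\<Sum>A\<in>Pow (insert x L). \<bar>rad_sum (insert x L) a A\<bar>)"
    proof -
      have "(\<Sum>A\<in>Pow (insert x L). \<bar>rad_sum (insert x L) a A\<bar>)
        = (\<Sum>A\<in>Pow L. \<bar>rad_sum (insert x L) a A\<bar>) + (\<Sum>A\<in>insert x ` Pow L. \<bar>rad_sum (insert x L) a A\<bar>)"
        unfolding Pow_eq using L(1,2) by (intro sum.union_disjoint) auto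
      also have "\<dots> = (\<Sum>A\<in>Pow L. \<bar>a x + rad_sum L a A\<bar>) + (\<Sum>A\<in>Pow L. \<bar>- a x + rad_sum L a A\<bar>)"
        unfolding sum.reindex[OF inj] o_def
        by (intro arg_cong2[of _ _ _ _ "(+)"] sum.cong) (auto simp: notin ins)
      finally show ?thesis by (simp add: sum.distrib)
    qed
    finally have "cube_avg L (\<lambda>A. \<bar>rad_sum L a A\<bar>)
        \<le> cube_avg (insert x L) (\<lambda>A. \<bar>rad_sum (insert x L) a A\<bar>)"
      unfolding cube_avg_def using L(1,2) by (simp add: field_simps)
    moreover have "cube_avg I (\<lambda>A. \<bar>rad_sum I a A\<bar>) \<le> cube_avg L (\<lambda>A. \<bar>rad_sum L a A\<bar>)"
      using insert.IH insert.prems unfolding L_def by blast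
    ultimately show ?case unfolding L(3) by (rule order_trans[rotated])
  qed simp
  from this[of "J - I"] show ?thesis
    using assms by (simp add: Un_absorb1)
qed

section \<open>Equality in Khinchine's inequality\<close>

lemma abs_le_by_sign:
  fixes q b V C :: real
  assumes "\<bar>q\<bar> \<le> V" "\<bar>b\<bar> \<le> C" "V - \<bar>b\<bar> \<le> C"
  shows "\<bar>q + b\<bar> \<le> C \<or> \<bar>q - b\<bar> \<le> C"
  using assms by linarith

lemma rad_sum_insert:
  assumes "finite F" "j \<notin> F" "A \<subseteq> F"
  shows "rad_sum (insert j F) a A = rad_sum F a A + a j"
    and "rad_sum (insert j F) a (insert j A) = rad_sum F a A - a j"
proof -
  have "j \<notin> A" using assms by blast
  then show "rad_sum (insert j F) a A = rad_sum F a A + a j"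
    using assms(1,2) by (simp add: rad_sum_def rad_def)
  have "rad_sum F a (insert j A) = rad_sum F a A"
    unfolding rad_sum_def using assms(2) by (intro sum.cong) (auto simp: rad_def)
  then show "rad_sum (insert j F) a (insert j A) = rad_sum F a A - a j"
    using assms(1,2) by (simp add: rad_sum_def) (simp add: rad_def)
qed

text \<open>
  Each sign is chosen opposite to the sum so far.
\<close>

lemma greedy_signs:
  assumes "finite F" "\<bar>p\<bar> \<le> C" "\<And>j. j \<in> F \<Longrightarrow> \<bar>a j\<bar> \<le> C"
  shows "\<exists>A\<subseteq>F. \<bar>p + rad_sum F a A\<bar> \<le> C"
  using assms(1,3)
proof (induction F rule: finite_induct)
  case empty
  then show ?case using assms(2) by (simp add: rad_sum_def)
next
  case (insert j F)
  then obtain A where A: "A \<subseteq> F" "\<bar>p + rad_sum F a A\<bar> \<le> C" by auto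
  have "\<bar>p + rad_sum F a A + a j\<bar> \<le> C \<or> \<bar>p + rad_sum F a A - a j\<bar> \<le> C"
    using A(2) insert.prems[of j] by (intro abs_le_by_sign[of _ C]) auto
  then show ?case
    using rad_sum_insert[OF insert.hyps(1,2) A(1), of a] A(1)
    by (metis add.assoc add_diff_eq insert_mono subset_insertI2)
qed

lemma balanced_signs:
  assumes "finite F" "\<And>j. j \<in> F \<Longrightarrow> \<bar>a j\<bar> = V"
  shows "\<exists>A\<subseteq>F. rad_sum F a A = (if even (card F) then 0 else V)"
  using assms
proof (induction F rule: finite_induct)
  case empty
  then show ?case by (simp add: rad_sum_def)
next
  case (insert j F)
  then obtain A where A: "A \<subseteq> F" "rad_sum F a A = (if even (card F) then 0 else V)" by auto
  have "\<bar>a j\<bar> = V" using insert.prems by simp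
  then have "rad_sum F a A + a j = (if even (card (insert j F)) then 0 else V) \<or>
      rad_sum F a A - a j = (if even (card (insert j F)) then 0 else V)"
    using A(2) insert.hyps by (auto simp: abs_if split: if_splits)
  then show ?case
    using rad_sum_insert[OF insert.hyps(1,2) A(1), of a] A(1)
    by (metis insert_mono subset_insertI2)
qed

lemma null_sequence_attains_max:
  fixes f :: "nat \<Rightarrow> real"
  assumes "f \<longlonglongrightarrow> 0"
  obtains m where "\<And>j. \<bar>f j\<bar> \<le> \<bar>f m\<bar>"
proof (cases "\<forall>j. f j = 0")
  case True
  then show ?thesis using that[of 0] by simp
next
  case False
  then obtain k where k: "f k \<noteq> 0" by blast
  obtain N where N: "\<And>n. n \<ge> N \<Longrightarrow> \<bar>f n\<bar> < \<bar>f k\<bar>"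
    using LIMSEQ_D[OF assms, of "\<bar>f k\<bar>"] k by auto
  have fin: "finite (insert k {..<N})" by simp
  have "Max ((\<lambda>j. \<bar>f j\<bar>) ` insert k {..<N}) \<in> (\<lambda>j. \<bar>f j\<bar>) ` insert k {..<N}"
    by (intro Max_in) auto
  then obtain m where m: "Max ((\<lambda>j. \<bar>f j\<bar>) ` insert k {..<N}) = \<bar>f m\<bar>"
    by auto
  have le: "\<bar>f j\<bar> \<le> \<bar>f m\<bar>" if "j \<in> insert k {..<N}" for j
    unfolding m[symmetric] by (rule Max_ge[OF finite_imageI[OF fin] imageI[OF that]])
  have "\<bar>f j\<bar> \<le> \<bar>f m\<bar>" for j
    using le[of j] le[of k] N[of j] by (cases "j < N") auto
  then show ?thesis by (rule that)
qed

text \<open>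
  The averages over the first \<open>n\<close> signs increase to the full average, for which Khinchine's
  inequality is the reverse of the last assumption. The assumption thus expresses equality
  without a measure on an infinite cube.
\<close>

locale khinchine_extremal =
  fixes a :: "nat \<Rightarrow> real"
  assumes summable_abs: "summable (\<lambda>j. \<bar>a j\<bar>)"
    and summable_sq: "summable (\<lambda>j. (a j)\<^sup>2)"
    and extremal: "2 * (cube_avg {..<n} (\<lambda>A. \<bar>rad_sum {..<n} a A\<bar>))\<^sup>2 \<le> (\<Sum>j. (a j)\<^sup>2)"
begin

text \<open>
  Truncations are almost extremal, so every loss in Khinchine's inequality for the first \<open>n\<close>
  coefficients tends to \<open>0\<close>.
\<close>

lemma deficit_le_tail:
  "2 * (cube_avg {..<n} (\<lambda>A. \<bar>rad_sum {..<n} a A\<bar>))\<^sup>2 - (\<Sum>j<n. (a j)\<^sup>2)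
     \<le> (\<Sum>j. (a (j + n))\<^sup>2)"
  using extremal[of n] suminf_split_initial_segment[OF summable_sq, of n] by simp

lemma dominated_avg_le_tail:
  assumes "i < n"
  shows "cube_avg {..<n} (\<lambda>A. max 0 ((a i)\<^sup>2 - (rad_sum ({..<n} - {i}) a A)\<^sup>2))
     \<le> (\<Sum>j. (a (j + n))\<^sup>2)"
proof -
  let ?g = "\<lambda>j. cube_avg {..<n} (\<lambda>A. max 0 ((a j)\<^sup>2 - (rad_sum ({..<n} - {j}) a A)\<^sup>2))"
  have "?g i \<le> (\<Sum>j<n. ?g j)"
    using assms by (intro member_le_sum) (auto intro!: cube_avg_nonneg)
  moreover have "0 \<le> (\<Sum>S\<in>{S\<in>Pow {..<n}. 4 \<le> card S}.
      (fourier {..<n} (\<lambda>A. \<bar>rad_sum {..<n} a A\<bar>) S)\<^sup>2)"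
    by (intro sum_nonneg) simp
  ultimately show ?thesis
    using khinchine_deficit[OF finite_lessThan, of n a] deficit_le_tail[of n] by simp
qed

lemma flip_diff4_avg_le_tail:
  assumes "{i, j, k, l} \<subseteq> {..<n}" "distinct [i, j, k, l]"
  shows "2 * cube_avg {..<n} (\<lambda>A. (flip_diff i (flip_diff j (flip_diff k (flip_diff l
      (\<lambda>A. \<bar>rad_sum {..<n} a A\<bar>)))) A)\<^sup>2) \<le> (\<Sum>j. (a (j + n))\<^sup>2)"
proof -
  have "0 \<le> (\<Sum>j<n. cube_avg {..<n} (\<lambda>A. max 0 ((a j)\<^sup>2 - (rad_sum ({..<n} - {j}) a A)\<^sup>2)))"
    by (intro sum_nonneg cube_avg_nonneg) simp
  then show ?thesis
    using khinchine_deficit[OF finite_lessThan, of n a] deficit_le_tail[of n]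
      flip_diff4_le[OF finite_lessThan assms, of "\<lambda>A. \<bar>rad_sum {..<n} a A\<bar>"]
    by linarith
qed

text \<open>
  Otherwise the same strict inequality would hold on a whole cylinder, whatever the signs from
  \<open>N\<close> on. The loss in the triangle inequality would then stay above a positive constant,
  but it is bounded by tails of a convergent series.
\<close>

lemma no_coefficient_dominates:
  assumes i: "i < N" and A: "A \<subseteq> {..<N}"
  shows "\<bar>a i\<bar> \<le> \<bar>rad_sum ({..<N} - {i}) a A\<bar> + (\<Sum>j. \<bar>a (j + N)\<bar>)"
proof (rule ccontr)
  define t where "t = (\<Sum>j. \<bar>a (j + N)\<bar>)"
  define c where "c = \<bar>rad_sum ({..<N} - {i}) a A\<bar> + t"
  define \<delta> where "\<delta> = (a i)\<^sup>2 - c\<^sup>2"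
  assume "\<not> ?thesis"
  then have less: "c < \<bar>a i\<bar>" by (simp add: c_def t_def)
  have sm: "summable (\<lambda>j. \<bar>a (j + N)\<bar>)"
    using summable_abs by (subst summable_iff_shift)
  have c0: "0 \<le> c" unfolding c_def t_def using sm by (simp add: suminf_nonneg)
  have "c\<^sup>2 < \<bar>a i\<bar>\<^sup>2" using less c0 by (intro power_strict_mono) auto
  then have \<delta>: "0 < \<delta>" by (simp add: \<delta>_def)
  have bound: "\<delta> / 2 ^ N \<le> (\<Sum>j. (a (j + n))\<^sup>2)" if "n \<ge> N" for n
  proof -
    have "\<delta> \<le> max 0 ((a i)\<^sup>2 - (rad_sum ({..<n} - {i}) a (A \<union> C))\<^sup>2)"
      if C: "C \<subseteq> {..<n} - {..<N}" for C
    proof -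
      have CN: "C \<inter> {..<N} = {}" using C by auto
      have split: "{..<n} - {i} = ({..<N} - {i}) \<union> {N..<n}"
        using \<open>n \<ge> N\<close> i by auto
      have "rad_sum ({..<n} - {i}) a (A \<union> C)
          = rad_sum ({..<N} - {i}) a (A \<union> C) + rad_sum {N..<n} a (A \<union> C)"
        unfolding split rad_sum_def by (intro sum.union_disjoint) auto
      moreover have "rad_sum ({..<N} - {i}) a (A \<union> C) = rad_sum ({..<N} - {i}) a A"
        unfolding rad_sum_def using CN by (intro sum.cong) (auto simp: rad_def)
      moreover have "\<bar>rad_sum {N..<n} a (A \<union> C)\<bar> \<le> t"
      proof -
        have "\<bar>rad_sum {N..<n} a (A \<union> C)\<bar> \<le> (\<Sum>j\<in>{N..<n}. \<bar>a j\<bar>)"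
          unfolding rad_sum_def by (rule order_trans[OF sum_abs]) (simp add: abs_mult)
        also have "\<dots> = (\<Sum>j<n - N. \<bar>a (j + N)\<bar>)"
          by (rule sum.reindex_bij_witness[of _ "\<lambda>j. j + N" "\<lambda>j. j - N"]) auto
        also have "\<dots> \<le> t"
          unfolding t_def using sm by (intro sum_le_suminf) auto
        finally show ?thesis .
      qed
      ultimately have "\<bar>rad_sum ({..<n} - {i}) a (A \<union> C)\<bar> \<le> c"
        unfolding c_def by linarith
      then have "(rad_sum ({..<n} - {i}) a (A \<union> C))\<^sup>2 \<le> c\<^sup>2"
        by (metis abs_ge_zero power2_abs power_mono)
      then show ?thesis by (simp add: \<delta>_def)
    qed
    then have "\<delta> / 2 ^ card {..<N}
      \<le> cube_avg {..<n} (\<lambda>A. max 0 ((a i)\<^sup>2 - (rad_sum ({..<n} - {i}) a A)\<^sup>2))"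
      using A that by (intro cube_avg_cylinder[of _ _ A]) auto
    also have "\<dots> \<le> (\<Sum>j. (a (j + n))\<^sup>2)"
      using i that by (intro dominated_avg_le_tail) simp
    finally show ?thesis by simp
  qed
  have "0 < \<delta> / 2 ^ N" using \<delta> by simp
  then obtain M where M: "\<And>n. n \<ge> M \<Longrightarrow> norm (\<Sum>j. (a (j + n))\<^sup>2) < \<delta> / 2 ^ N"
    using suminf_exist_split[OF _ summable_sq] by blast
  show False
    using bound[of "max M N"] M[of "max M N"] by simp
qed

text \<open>
  If a smaller nonzero coefficient exists, signs can be chosen such that the maximal coefficient
  dominates the others: the greedy choice keeps the modulus of the sum of the other maximal
  coefficients at most \<open>V\<close>, the smaller coefficient moves it below \<open>V\<close>, and
  the remaining ones are too small to bring it back.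
\<close>

lemma nonzero_coefficients_equal:
  assumes m: "\<And>j. \<bar>a j\<bar> \<le> \<bar>a m\<bar>" and nz: "a j0 \<noteq> 0"
  shows "\<bar>a j0\<bar> = \<bar>a m\<bar>"
proof (rule ccontr)
  assume ne: "\<bar>a j0\<bar> \<noteq> \<bar>a m\<bar>"
  define V where "V = \<bar>a m\<bar>"
  define M where "M = {j. \<bar>a j\<bar> = V}"
  have V: "0 < V" using m[of j0] nz unfolding V_def by linarith
  have lim: "a \<longlonglongrightarrow> 0"
    using summable_LIMSEQ_zero[OF summable_abs] by (simp add: tendsto_rabs_zero_iff)
  obtain N0 where N0: "\<And>n. n \<ge> N0 \<Longrightarrow> \<bar>a n\<bar> < V"
    using LIMSEQ_D[OF lim V] by auto
  then have "M \<subseteq> {..<N0}" unfolding M_def by (auto simp: not_less[symmetric])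
  then have finM: "finite M" by (rule finite_subset) simp
  \<comment> \<open>The second largest modulus is the maximum of the null sequence with \<open>M\<close> erased.\<close>
  define a' where "a' j = (if j \<in> M then 0 else a j)" for j
  have "a' \<longlonglongrightarrow> 0"
    by (rule tendsto_rabs_zero_cancel, rule tendsto_sandwich[OF _ _ tendsto_const tendsto_rabs_zero[OF lim]])
       (auto simp: a'_def)
  then obtain b where b: "\<And>j. \<bar>a' j\<bar> \<le> \<bar>a' b\<bar>" by (rule null_sequence_attains_max) blast
  define B where "B = \<bar>a' b\<bar>"
  have B: "B < V" using m[of b] V unfolding B_def a'_def M_def V_def by auto
  have le_B: "\<bar>a j\<bar> \<le> B" if "j \<notin> M" for j
    using b[of j] that unfolding B_def a'_def by simp
  have j0: "j0 \<notin> M" using ne unfolding M_def V_def by simp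
  \<comment> \<open>The sum after the step at \<open>j0\<close> and all later coefficients have modulus at most \<open>C\<close>.\<close>
  define C where "C = max (V - \<bar>a j0\<bar>) B"
  have C: "C < V" using B nz unfolding C_def by simp
  have "0 < V - C" using C by simp
  then obtain N1 where N1: "\<And>n. n \<ge> N1 \<Longrightarrow> norm (\<Sum>j. \<bar>a (j + n)\<bar>) < V - C"
    using suminf_exist_split[OF _ summable_abs] by blast
  define N where "N = Max {N0, N1, Suc j0}"
  have N: "N0 \<le> N" "N1 \<le> N" "j0 < N" unfolding N_def by auto
  have tail: "(\<Sum>j. \<bar>a (j + N)\<bar>) < V - C" using N1[OF N(2)] by simp
  have MN: "M \<subseteq> {..<N}" using \<open>M \<subseteq> {..<N0}\<close> N(1) by auto
  have mM: "m \<in> M" unfolding M_def V_def by simp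
  obtain A1 where A1: "A1 \<subseteq> M - {m}" "\<bar>0 + rad_sum (M - {m}) a A1\<bar> \<le> V"
    using greedy_signs[of "M - {m}" 0 V a] finM V unfolding M_def by auto
  have "\<bar>rad_sum (M - {m}) a A1 + a j0\<bar> \<le> C \<or> \<bar>rad_sum (M - {m}) a A1 - a j0\<bar> \<le> C"
    using A1(2) le_B[OF j0] unfolding C_def by (intro abs_le_by_sign[of _ V]) auto
  then obtain A2 where A2: "A2 \<subseteq> insert j0 (M - {m})" "\<bar>rad_sum (insert j0 (M - {m})) a A2\<bar> \<le> C"
    using rad_sum_insert[of "M - {m}" j0 A1 a] A1(1) finM j0
    by (metis finite_Diff DiffD1 insert_mono subset_insertI2)
  obtain A3 where A3: "A3 \<subseteq> {..<N} - M - {j0}"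
    "\<bar>rad_sum (insert j0 (M - {m})) a A2 + rad_sum ({..<N} - M - {j0}) a A3\<bar> \<le> C"
    using greedy_signs[of "{..<N} - M - {j0}" _ C a, OF _ A2(2)] le_B unfolding C_def by fastforce
  have "rad_sum (insert j0 (M - {m}) \<union> ({..<N} - M - {j0})) a (A2 \<union> A3)
      = rad_sum (insert j0 (M - {m})) a A2 + rad_sum ({..<N} - M - {j0}) a A3"
    using A2(1) A3(1) finM by (intro rad_sum_Un) auto
  moreover have "insert j0 (M - {m}) \<union> ({..<N} - M - {j0}) = {..<N} - {m}"
    using MN N(3) mM j0 by auto
  ultimately have "\<bar>rad_sum ({..<N} - {m}) a (A2 \<union> A3)\<bar> \<le> C" using A3(2) by simp
  moreover have "A2 \<union> A3 \<subseteq> {..<N}" using A2(1) A3(1) MN N(3) by auto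
  moreover have "m < N" using mM MN by auto
  ultimately show False
    using no_coefficient_dominates[of m N "A2 \<union> A3"] tail unfolding V_def by simp
qed

text \<open>
  If the number of coefficients of the common modulus \<open>V\<close> is odd, the other ones balance to
  \<open>0\<close> and one coefficient dominates. If it is even and at least four, balanced signs give a point with
  nonzero fourth mixed difference, while the support is finite, so the deficit of a long
  truncation vanishes.
\<close>

theorem two_equal_coefficients:
  assumes "a j0 \<noteq> 0"
  shows "card {j. a j \<noteq> 0} = 2" and "a j1 \<noteq> 0 \<Longrightarrow> \<bar>a j0\<bar> = \<bar>a j1\<bar>"
proof -
  have lim: "a \<longlonglongrightarrow> 0"
    using summable_LIMSEQ_zero[OF summable_abs] by (simp add: tendsto_rabs_zero_iff)
  then obtain m where m: "\<And>j. \<bar>a j\<bar> \<le> \<bar>a m\<bar>" by (rule null_sequence_attains_max) blast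
  define V where "V = \<bar>a m\<bar>"
  have eq: "\<bar>a j\<bar> = V" if "a j \<noteq> 0" for j
    using nonzero_coefficients_equal[OF m that] by (simp add: V_def)
  then show "a j1 \<noteq> 0 \<Longrightarrow> \<bar>a j0\<bar> = \<bar>a j1\<bar>" using assms by simp
  have V: "0 < V" using eq[OF assms] assms by simp
  define M where "M = {j. a j \<noteq> 0}"
  obtain N where N: "\<And>n. n \<ge> N \<Longrightarrow> \<bar>a n\<bar> < V"
    using LIMSEQ_D[OF lim V] by auto
  have MN: "M \<subseteq> {..<N}"
  proof
    fix j assume "j \<in> M"
    then have "\<bar>a j\<bar> = V" using eq by (simp add: M_def)
    then show "j \<in> {..<N}" using N[of j] by (cases "j < N") auto
  qed
  then have finM: "finite M" by (rule finite_subset) simp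
  have zero: "a (j + N) = 0" for j using MN unfolding M_def by auto
  have restrict: "rad_sum ({..<N} - K) a A = rad_sum (M - K) a A" for K A
    unfolding rad_sum_def using MN by (intro sum.mono_neutral_right) (auto simp: M_def)
  have mM: "m \<in> M" using V unfolding M_def V_def by auto
  have "even (card M)"
  proof (rule ccontr)
    assume "odd (card M)"
    then have "even (card (M - {m}))" using mM finM by (simp add: card_Diff_singleton)
    then obtain A where A: "A \<subseteq> M - {m}" "rad_sum (M - {m}) a A = 0"
      using balanced_signs[of "M - {m}" a V] finM eq unfolding M_def by auto
    have "\<bar>a m\<bar> \<le> \<bar>rad_sum ({..<N} - {m}) a A\<bar> + (\<Sum>j. \<bar>a (j + N)\<bar>)"
      using mM MN A(1) by (intro no_coefficient_dominates) auto
    then show False using V A(2) unfolding restrict by (simp add: zero V_def)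
  qed
  moreover have "\<not> 4 \<le> card M"
  proof
    assume "4 \<le> card M"
    then obtain Q where Q: "Q \<subseteq> M" "card Q = 4" using obtain_subset_with_card_n by metis
    then obtain i j k l where ijkl: "Q = {i, j, k, l}" "distinct [i, j, k, l]"
    proof -
      obtain xs where xs: "set xs = Q" "distinct xs"
        using finite_distinct_list[OF finite_subset[OF Q(1) finM]] by blast
      then have "length xs = 4" using Q(2) distinct_card by metis
      then obtain i j k l where "xs = [i, j, k, l]"
        by (auto simp: numeral_eq_Suc length_Suc_conv)
      then show ?thesis using xs that by auto
    qed
    have nz: "a i \<noteq> 0" "a j \<noteq> 0" "a k \<noteq> 0" "a l \<noteq> 0" using Q(1) ijkl(1) unfolding M_def by auto
    have finQ: "finite Q" using ijkl(1) by simp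
    have "card (M - Q) = card M - 4" using Q by (simp add: card_Diff_subset finQ)
    then have "even (card (M - Q))" using \<open>even (card M)\<close> by simp
    then obtain A0 where A0: "A0 \<subseteq> M - Q" "rad_sum (M - Q) a A0 = 0"
      using balanced_signs[of "M - Q" a V] finM eq unfolding M_def by auto
    \<comment> \<open>The signs on \<open>Q\<close> make the four terms equal to \<open>V, V, - V, - V\<close>.\<close>
    define A1 where "A1 = {x \<in> {i, j}. a x < 0} \<union> {x \<in> {k, l}. a x > 0}"
    define A where "A = A1 \<union> A0"
    have A1: "A1 \<subseteq> Q" unfolding A1_def ijkl(1) by auto
    have signs: "a i * rad B i = V" "a j * rad B j = V" "a k * rad B k = - V" "a l * rad B l = - V"
      if "B \<inter> Q = A1" for B
    proof -
      have iff: "x \<in> B \<longleftrightarrow> x \<in> A1" if "x \<in> Q" for x using \<open>B \<inter> Q = A1\<close> that by auto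
      have "i \<in> B \<longleftrightarrow> a i < 0" "j \<in> B \<longleftrightarrow> a j < 0" "k \<in> B \<longleftrightarrow> a k > 0" "l \<in> B \<longleftrightarrow> a l > 0"
        using iff[of i] iff[of j] iff[of k] iff[of l] ijkl(2) unfolding A1_def ijkl(1) by auto
      then show "a i * rad B i = V" "a j * rad B j = V" "a k * rad B k = - V" "a l * rad B l = - V"
        using eq[OF nz(1)] eq[OF nz(2)] eq[OF nz(3)] eq[OF nz(4)] nz
        unfolding rad_def by (auto simp: abs_if split: if_splits)
    qed
    have "A1 \<inter> Q = A1" "A \<inter> Q = A1" using A1 A0(1) unfolding A_def by auto
    have "rad_sum Q a A1 = 0"
      using signs[OF \<open>A1 \<inter> Q = A1\<close>] ijkl(2) unfolding rad_sum_def ijkl(1) by simp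
    then have "rad_sum (Q \<union> (M - Q)) a A = 0"
      unfolding A_def using A0 A1 finM finQ by (subst rad_sum_Un) auto
    moreover have "Q \<union> (M - Q) = M" using Q(1) by auto
    ultimately have "rad_sum {..<N} a A = 0" using restrict[of "{}" A] by simp
    then have D4: "flip_diff i (flip_diff j (flip_diff k (flip_diff l
        (\<lambda>A. \<bar>rad_sum {..<N} a A\<bar>)))) A = - V / 2"
      using signs[OF \<open>A \<inter> Q = A1\<close>] Q(1) MN V ijkl
      by (intro flip_diff4_balanced) auto
    have "(V / 2)\<^sup>2 / 2 ^ card {..<N} \<le> cube_avg {..<N} (\<lambda>A. (flip_diff i (flip_diff j
        (flip_diff k (flip_diff l (\<lambda>A. \<bar>rad_sum {..<N} a A\<bar>)))) A)\<^sup>2)"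
    proof (rule cube_avg_cylinder)
      show "A \<subseteq> {..<N}" using A0(1) A1 Q(1) MN unfolding A_def by auto
    qed (auto simp: D4 power_divide)
    moreover have "0 < (V / 2)\<^sup>2 / 2 ^ card {..<N}" using V by simp
    moreover have "2 * cube_avg {..<N} (\<lambda>A. (flip_diff i (flip_diff j
        (flip_diff k (flip_diff l (\<lambda>A. \<bar>rad_sum {..<N} a A\<bar>)))) A)\<^sup>2) \<le> 0"
    proof -
      have "{i, j, k, l} \<subseteq> {..<N}" using Q(1) MN ijkl(1) by blast
      from flip_diff4_avg_le_tail[OF this ijkl(2)] show ?thesis by (simp add: zero)
    qed
    ultimately show False by linarith
  qed
  moreover have "card M \<noteq> 0" using mM finM by auto
  ultimately show "card {j. a j \<noteq> 0} = 2" unfolding M_def[symmetric] by presburger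
qed

end

section \<open>A mixed-norm inequality for the exponent four thirds\<close>

lemma sum_powr_holder:
  fixes f g :: "'a \<Rightarrow> real"
  assumes "finite F" "\<And>i. i \<in> F \<Longrightarrow> 0 \<le> f i" "\<And>i. i \<in> F \<Longrightarrow> 0 \<le> g i"
    and "0 < \<alpha>" "0 < \<beta>" "\<alpha> + \<beta> = 1"
  shows "(\<Sum>i\<in>F. f i powr \<alpha> * g i powr \<beta>) \<le> (\<Sum>i\<in>F. f i) powr \<alpha> * (\<Sum>i\<in>F. g i) powr \<beta>"
proof (cases "(\<Sum>i\<in>F. f i) = 0 \<or> (\<Sum>i\<in>F. g i) = 0")
  case True
  then have "(\<forall>i\<in>F. f i = 0) \<or> (\<forall>i\<in>F. g i = 0)"
    using assms(1-3) by (metis sum_nonneg_eq_0_iff)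
  then have "(\<Sum>i\<in>F. f i powr \<alpha> * g i powr \<beta>) = 0"
    by (intro sum.neutral) auto
  then show ?thesis by simp
next
  case False
  define X where "X = (\<Sum>i\<in>F. f i)"
  define Y where "Y = (\<Sum>i\<in>F. g i)"
  have X: "0 < X" and Y: "0 < Y"
    using False sum_nonneg[of F f, OF assms(2)] sum_nonneg[of F g, OF assms(3)]
    unfolding X_def Y_def by linarith+
  have "f i powr \<alpha> * g i powr \<beta> \<le> (X powr \<alpha> * Y powr \<beta>) * (\<alpha> / X * f i + \<beta> / Y * g i)"
    if i: "i \<in> F" for i
  proof (cases "f i = 0 \<or> g i = 0")
    case True
    moreover have "0 \<le> (X powr \<alpha> * Y powr \<beta>) * (\<alpha> / X * f i + \<beta> / Y * g i)"
      using X Y assms i by (intro mult_nonneg_nonneg add_nonneg_nonneg) auto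
    ultimately show ?thesis by auto
  next
    case nz: False
    then have "(f i / X) powr \<alpha> * (g i / Y) powr \<beta> \<le> \<alpha> * (f i / X) + \<beta> * (g i / Y)"
      using X Y assms i by (intro Youngs_inequality_0 divide_pos_pos) (auto simp: order_less_le)
    then have "(X powr \<alpha> * Y powr \<beta>) * ((f i / X) powr \<alpha> * (g i / Y) powr \<beta>)
        \<le> (X powr \<alpha> * Y powr \<beta>) * (\<alpha> * (f i / X) + \<beta> * (g i / Y))"
      by (intro mult_left_mono) auto
    then show ?thesis using X Y assms i by (simp add: powr_divide)
  qed
  then have "(\<Sum>i\<in>F. f i powr \<alpha> * g i powr \<beta>)
      \<le> (\<Sum>i\<in>F. (X powr \<alpha> * Y powr \<beta>) * (\<alpha> / X * f i + \<beta> / Y * g i))"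
    by (rule sum_mono)
  also have "\<dots> = (X powr \<alpha> * Y powr \<beta>) * (\<alpha> / X * X + \<beta> / Y * Y)"
    by (simp only: X_def Y_def sum_distrib_left[symmetric] sum.distrib)
  also have "\<dots> = X powr \<alpha> * Y powr \<beta>" using X Y assms(6) by simp
  finally show ?thesis by (simp add: X_def Y_def)
qed

lemma L2_set_sum_le: "finite G \<Longrightarrow> L2_set (\<lambda>i. \<Sum>j\<in>G. f i j) F \<le> (\<Sum>j\<in>G. L2_set (\<lambda>i. f i j) F)"
proof (induction G rule: finite_induct)
  case empty
  then show ?case by (simp add: L2_set_0')
next
  case (insert j G)
  then show ?case
    using L2_set_triangle_ineq[of "\<lambda>i. f i j" "\<lambda>i. \<Sum>j\<in>G. f i j" F] by simp
qed

lemma square_powr_third: "0 \<le> x \<Longrightarrow> (x\<^sup>2) powr (1/3) = x powr (2/3)" for x :: real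
  by (cases "x = 0") (simp_all add: powr_powr flip: powr_numeral)

text \<open>
  Split the exponent as \<open>4/3 = 2 * (1/3) + 2/3\<close>. Hoelder's inequality with weights
  \<open>1/3, 2/3\<close> along each row and with weights \<open>2/3, 1/3\<close> across the rows leaves the
  Euclidean norm of the row sums of \<open>\<bar>a i j\<bar>\<close>, which Minkowski's inequality bounds by the sum of
  the column norms.
\<close>

lemma sum_powr_four_thirds_le:
  fixes a :: "'a \<Rightarrow> 'b \<Rightarrow> real"
  assumes "finite F" "finite G"
  shows "(\<Sum>i\<in>F. \<Sum>j\<in>G. \<bar>a i j\<bar> powr (4/3))
     \<le> (\<Sum>i\<in>F. L2_set (a i) G) powr (2/3) * (\<Sum>j\<in>G. L2_set (\<lambda>i. a i j) F) powr (2/3)"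
proof -
  define s where "s i = (\<Sum>j\<in>G. \<bar>a i j\<bar>)" for i
  have s: "0 \<le> s i" for i unfolding s_def by (intro sum_nonneg) simp
  have L2_sq: "(L2_set f A)\<^sup>2 = (\<Sum>i\<in>A. (f i)\<^sup>2)" for f :: "'c \<Rightarrow> real" and A
    unfolding L2_set_def by (simp add: sum_nonneg)
  have row: "(\<Sum>j\<in>G. \<bar>a i j\<bar> powr (4/3)) \<le> L2_set (a i) G powr (2/3) * ((s i)\<^sup>2) powr (1/3)" for i
  proof -
    have "(\<Sum>j\<in>G. \<bar>a i j\<bar> powr (4/3)) = (\<Sum>j\<in>G. ((a i j)\<^sup>2) powr (1/3) * \<bar>a i j\<bar> powr (2/3))"
      using square_powr_third[of "\<bar>a i _\<bar>"] by (intro sum.cong) (simp_all flip: powr_add)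
    also have "\<dots> \<le> (\<Sum>j\<in>G. (a i j)\<^sup>2) powr (1/3) * (s i) powr (2/3)"
      unfolding s_def using assms(2) by (intro sum_powr_holder) auto
    finally show ?thesis
      using s[of i] by (simp add: square_powr_third flip: L2_sq)
  qed
  have "(\<Sum>i\<in>F. \<Sum>j\<in>G. \<bar>a i j\<bar> powr (4/3))
      \<le> (\<Sum>i\<in>F. L2_set (a i) G powr (2/3) * ((s i)\<^sup>2) powr (1/3))"
    by (rule sum_mono) (rule row)
  also have "\<dots> \<le> (\<Sum>i\<in>F. L2_set (a i) G) powr (2/3) * (\<Sum>i\<in>F. (s i)\<^sup>2) powr (1/3)"
    using assms(1) by (intro sum_powr_holder) auto
  also have "(\<Sum>i\<in>F. (s i)\<^sup>2) powr (1/3) = L2_set s F powr (2/3)"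
    by (simp add: square_powr_third flip: L2_sq)
  also have "\<dots> \<le> (\<Sum>j\<in>G. L2_set (\<lambda>i. a i j) F) powr (2/3)"
    using L2_set_sum_le[OF assms(2), of "\<lambda>i j. \<bar>a i j\<bar>" F]
    by (intro powr_mono2) (simp_all add: s_def L2_set_def sum_nonneg)
  finally show ?thesis by (simp add: mult_left_mono)
qed

section \<open>Matrices extremal for Littlewood's inequality\<close>

text \<open>
  The two properties of the coefficients of an extremum that the argument uses. The second says
  that the sum of the powers is at least \<open>2 powr (2/3)\<close>, the \<open>4/3\<close> power of \<open>sqrt 2\<close>;
  stated through upper bounds of square truncations, it is visibly invariant under transposition.
\<close>

locale littlewood_extremal_matrix =
  fixes a :: "nat \<Rightarrow> nat \<Rightarrow> real"
  assumes form_le_1: "\<lbrakk>\<And>i. \<bar>x i\<bar> \<le> 1; \<And>j. \<bar>y j\<bar> \<le> 1\<rbrakk>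
      \<Longrightarrow> (\<Sum>i<m. \<Sum>j<n. a i j * x i * y j) \<le> 1"
    and powr_sum_extremal: "(\<And>n. (\<Sum>i<n. \<Sum>j<n. \<bar>a i j\<bar> powr (4/3)) \<le> c) \<Longrightarrow> 2 powr (2/3) \<le> c"
begin

lemma transpose: "littlewood_extremal_matrix (\<lambda>i j. a j i)"
proof
  fix x y :: "nat \<Rightarrow> real" and m n
  assume "\<And>i. \<bar>x i\<bar> \<le> 1" "\<And>j. \<bar>y j\<bar> \<le> 1"
  then show "(\<Sum>i<m. \<Sum>j<n. a j i * x i * y j) \<le> 1"
    using form_le_1[where x = y and y = x and m = n and n = m] sum.swap[of "\<lambda>i j. a j i * x i * y j" "{..<n}" "{..<m}"]
    by (simp add: mult_ac)
next
  fix c assume "\<And>n. (\<Sum>i<n. \<Sum>j<n. \<bar>a j i\<bar> powr (4/3)) \<le> c"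
  then have "(\<Sum>i<n. \<Sum>j<n. \<bar>a i j\<bar> powr (4/3)) \<le> c" for n
    by (subst sum.swap)
  then show "2 powr (2/3) \<le> c" by (rule powr_sum_extremal)
qed

lemma sum_abs_row_le_1: "(\<Sum>j<n. \<bar>a i j\<bar>) \<le> 1"
proof -
  have "(\<Sum>k<Suc i. \<Sum>j<n. a k j * (if k = i then 1 else 0) * sgn (a i j)) \<le> 1"
    by (rule form_le_1) (auto simp: sgn_real_def)
  also have "(\<Sum>k<Suc i. \<Sum>j<n. a k j * (if k = i then 1 else 0) * sgn (a i j))
      = (\<Sum>k<Suc i. if k = i then (\<Sum>j<n. \<bar>a i j\<bar>) else 0)"
    by (intro sum.cong refl) (auto simp: abs_sgn)
  finally show ?thesis by simp
qed

lemma summable_abs_row: "summable (\<lambda>j. \<bar>a i j\<bar>)"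
  by (rule summableI_nonneg_bounded[where x = 1]) (simp_all add: sum_abs_row_le_1)

lemma summable_sq_row: "summable (\<lambda>j. (a i j)\<^sup>2)"
proof (rule summable_comparison_test'[OF summable_abs_row])
  fix j :: nat
  have "\<bar>a i j\<bar> \<le> (\<Sum>k<Suc j. \<bar>a i k\<bar>)" by simp
  also have "\<dots> \<le> 1" by (rule sum_abs_row_le_1)
  finally have "\<bar>a i j\<bar> * \<bar>a i j\<bar> \<le> \<bar>a i j\<bar> * 1" by (intro mult_left_mono) auto
  then show "norm ((a i j)\<^sup>2) \<le> \<bar>a i j\<bar>" by (simp add: power2_eq_square abs_mult)
qed

definition row_avg :: "nat \<Rightarrow> nat \<Rightarrow> real" where
  "row_avg n i = cube_avg {..<n} (\<lambda>A. \<bar>rad_sum {..<n} (a i) A\<bar>)"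

text \<open>
  For fixed signs on the columns, the sum of the absolute values is the form evaluated at these
  signs and at the signs of the row sums.
\<close>

lemma sum_row_avg_le_1: "(\<Sum>i<m. row_avg n i) \<le> 1"
proof -
  have "(\<Sum>i<m. \<bar>rad_sum {..<n} (a i) A\<bar>) \<le> 1" for A
  proof -
    have "(\<Sum>i<m. \<Sum>j<n. a i j * sgn (rad_sum {..<n} (a i) A) * rad A j) \<le> 1"
      by (rule form_le_1) (auto simp: sgn_real_def)
    moreover have "(\<Sum>j<n. a i j * sgn (rad_sum {..<n} (a i) A) * rad A j)
        = \<bar>rad_sum {..<n} (a i) A\<bar>" for i
    proof -
      have "(\<Sum>j<n. a i j * s * rad A j) = rad_sum {..<n} (a i) A * s" for s
        by (simp add: rad_sum_def sum_distrib_left mult_ac)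
      then show ?thesis by (simp only: abs_sgn)
    qed
    ultimately show ?thesis by simp
  qed
  then have "cube_avg {..<n} (\<lambda>A. \<Sum>i<m. \<bar>rad_sum {..<n} (a i) A\<bar>) \<le> cube_avg {..<n} (\<lambda>A. 1)"
    by (intro cube_avg_mono)
  then show ?thesis by (simp add: row_avg_def cube_avg_sum cube_avg_const)
qed

lemma L2_row_le: "L2_set (a i) {..<n} \<le> sqrt 2 * row_avg n i"
  unfolding row_avg_def by (rule khinchine) simp

lemma sum_L2_row_le: "(\<Sum>i<m. L2_set (a i) {..<n}) \<le> sqrt 2"
proof -
  have "(\<Sum>i<m. L2_set (a i) {..<n}) \<le> sqrt 2 * (\<Sum>i<m. row_avg n i)"
    unfolding sum_distrib_left by (intro sum_mono L2_row_le)
  also have "\<dots> \<le> sqrt 2 * 1"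
    by (intro mult_left_mono sum_row_avg_le_1) simp
  finally show ?thesis by simp
qed

text \<open>
  If one row had a strict inequality, the row norms of all large truncations would sum to at most
  \<open>sqrt 2 - \<epsilon>\<close>; together with the bound \<open>sqrt 2\<close> for the columns, the mixed-norm inequality
  would keep the sum of the powers below its extremal value.
\<close>

lemma row_khinchine_extremal: "2 * (row_avg n i)\<^sup>2 \<le> (\<Sum>j. (a i j)\<^sup>2)"
proof (rule ccontr)
  interpret tr: littlewood_extremal_matrix "\<lambda>i j. a j i" by (rule transpose)
  define r where "r = sqrt (\<Sum>j. (a i j)\<^sup>2)"
  define \<epsilon> where "\<epsilon> = sqrt 2 * row_avg n i - r"
  assume "\<not> ?thesis"
  then have "r < sqrt (2 * (row_avg n i)\<^sup>2)"
    unfolding r_def by simp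
  moreover have "0 \<le> row_avg n i" unfolding row_avg_def by (intro cube_avg_nonneg) simp
  ultimately have \<epsilon>: "0 < \<epsilon>" unfolding \<epsilon>_def by (simp add: real_sqrt_mult)
  have L2_le_r: "L2_set (a i) {..<N} \<le> r" for N
    unfolding L2_set_def r_def using summable_sq_row
    by (intro real_sqrt_le_mono sum_le_suminf) auto
  have rows: "(\<Sum>k<N. L2_set (a k) {..<N}) \<le> sqrt 2 - \<epsilon>" if N: "n \<le> N" "i < N" for N
  proof -
    have "row_avg n i \<le> row_avg N i"
      unfolding row_avg_def using N by (intro cube_avg_abs_rad_sum_mono) auto
    then have avg: "sqrt 2 * row_avg n i \<le> sqrt 2 * row_avg N i" by simp
    have "(\<Sum>k\<in>{..<N} - {i}. L2_set (a k) {..<N}) \<le> (\<Sum>k\<in>{..<N} - {i}. sqrt 2 * row_avg N k)"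
      by (intro sum_mono L2_row_le)
    moreover have "(\<Sum>k<N. L2_set (a k) {..<N})
        = L2_set (a i) {..<N} + (\<Sum>k\<in>{..<N} - {i}. L2_set (a k) {..<N})"
      using N by (intro sum.remove) auto
    moreover have "(\<Sum>k<N. sqrt 2 * row_avg N k)
        = sqrt 2 * row_avg N i + (\<Sum>k\<in>{..<N} - {i}. sqrt 2 * row_avg N k)"
      using N by (intro sum.remove) auto
    moreover have "(\<Sum>k<N. sqrt 2 * row_avg N k) \<le> sqrt 2"
      using mult_left_mono[OF sum_row_avg_le_1[of N N], of "sqrt 2"]
      by (simp add: sum_distrib_left)
    ultimately show ?thesis using avg L2_le_r[of N] unfolding \<epsilon>_def by linarith
  qed
  have nonneg: "0 \<le> sqrt 2 - \<epsilon>"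
    by (rule order_trans[OF _ rows[of "max n (Suc i)"]]) (auto intro: sum_nonneg)
  have "(\<Sum>k<M. \<Sum>j<M. \<bar>a k j\<bar> powr (4/3)) \<le> (sqrt 2 - \<epsilon>) powr (2/3) * sqrt 2 powr (2/3)" for M
  proof -
    define N where "N = max M (max n (Suc i))"
    have N: "M \<le> N" "n \<le> N" "i < N" unfolding N_def by auto
    have "(\<Sum>k<M. \<Sum>j<M. \<bar>a k j\<bar> powr (4/3)) \<le> (\<Sum>k<M. \<Sum>j<N. \<bar>a k j\<bar> powr (4/3))"
      using N by (intro sum_mono sum_mono2) auto
    also have "\<dots> \<le> (\<Sum>k<N. \<Sum>j<N. \<bar>a k j\<bar> powr (4/3))"
      using N by (intro sum_mono2) (auto intro: sum_nonneg)
    also have "\<dots> \<le> (\<Sum>k<N. L2_set (a k) {..<N}) powr (2/3)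
        * (\<Sum>j<N. L2_set (\<lambda>k. a k j) {..<N}) powr (2/3)"
      by (rule sum_powr_four_thirds_le) auto
    also have "\<dots> \<le> (sqrt 2 - \<epsilon>) powr (2/3) * sqrt 2 powr (2/3)"
      using rows[OF N(2,3)] tr.sum_L2_row_le[of N N]
      by (intro mult_mono powr_mono2) (auto intro: sum_nonneg)
    finally show ?thesis .
  qed
  then have "2 powr (2/3) \<le> (sqrt 2 - \<epsilon>) powr (2/3) * sqrt 2 powr (2/3)"
    by (rule powr_sum_extremal)
  also have "\<dots> < sqrt 2 powr (2/3) * sqrt 2 powr (2/3)"
    using nonneg \<epsilon> by (intro mult_strict_right_mono powr_less_mono2) auto
  also have "\<dots> = 2 powr (2/3)"
    by (simp flip: powr_mult)
  finally show False by simp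
qed

lemma row_two_equal_entries:
  assumes "a i j0 \<noteq> 0"
  shows "card {j. a i j \<noteq> 0} = 2" and "a i j1 \<noteq> 0 \<Longrightarrow> \<bar>a i j0\<bar> = \<bar>a i j1\<bar>"
proof -
  interpret row: khinchine_extremal "a i"
    by standard
      (use summable_abs_row summable_sq_row row_khinchine_extremal[unfolded row_avg_def] in auto)
  show "card {j. a i j \<noteq> 0} = 2" by (rule row.two_equal_coefficients[OF assms])
  show "a i j1 \<noteq> 0 \<Longrightarrow> \<bar>a i j0\<bar> = \<bar>a i j1\<bar>" by (rule row.two_equal_coefficients[OF assms])
qed

lemma nonzero_entry: "\<exists>i j. a i j \<noteq> 0"
proof (rule ccontr)
  assume "\<not> ?thesis"
  then have "(2::real) powr (2/3) \<le> 0" by (intro powr_sum_extremal) simp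
  then show False by simp
qed

end

section \<open>Extremal bilinear forms\<close>

lemma bilinear_form_le_norm:
  assumes "bounded_bilinear T" "norm x \<le> 1" "norm y \<le> 1"
  shows "T x y \<le> bilinear_form_norm T"
proof -
  have "\<bar>T x y\<bar> \<le> bilinear_form_norm T"
    unfolding bilinear_form_norm_def
    by (rule cSup_upper[OF _ bdd_above_bilinear_form_norm[OF assms(1)]]) (use assms in blast)
  then show ?thesis by simp
qed

lemma norm_sum_basis_le_1:
  assumes "\<And>i. \<bar>x i\<bar> \<le> 1"
  shows "norm (\<Sum>i<n. x i *\<^sub>R c0_basis i) \<le> 1"
proof (rule norm_c0_le)
  fix k
  have "c0_nth (\<Sum>i<n. x i *\<^sub>R c0_basis i) k = (if k < n then x k else 0)"
    by (simp add: c0_nth_sum c0_basis.rep_eq if_distrib[of "(*) _"] cong: if_cong)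
  then show "\<bar>c0_nth (\<Sum>i<n. x i *\<^sub>R c0_basis i) k\<bar> \<le> 1" using assms by simp
qed

text \<open>
  The infinite sum in the definition of an extremum is a genuine one: its value is nonzero,
  so the family is summable and the sum is the supremum of its finite partial sums.
\<close>

lemma extremum_matrix:
  assumes T: "bounded_bilinear T" and ext: "littlewood_extremum T"
  shows "littlewood_extremal_matrix (bilinear_form_coeff T)"
proof
  interpret bounded_bilinear T by (rule T)
  fix x y :: "nat \<Rightarrow> real" and m n
  assume "\<And>i. \<bar>x i\<bar> \<le> 1" "\<And>j. \<bar>y j\<bar> \<le> 1"
  then have "T (\<Sum>i<m. x i *\<^sub>R c0_basis i) (\<Sum>j<n. y j *\<^sub>R c0_basis j) \<le> bilinear_form_norm T"
    by (intro bilinear_form_le_norm T norm_sum_basis_le_1)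
  also have "\<dots> = 1" using ext by (simp add: littlewood_extremum_def)
  also have "T (\<Sum>i<m. x i *\<^sub>R c0_basis i) (\<Sum>j<n. y j *\<^sub>R c0_basis j)
      = (\<Sum>i<m. \<Sum>j<n. bilinear_form_coeff T i j * x i * y j)"
    by (simp add: sum_left sum_right scaleR_left scaleR_right bilinear_form_coeff_def
        sum_distrib_left mult_ac) (rule sum.swap)
  finally show "(\<Sum>i<m. \<Sum>j<n. bilinear_form_coeff T i j * x i * y j) \<le> 1" .
next
  let ?f = "\<lambda>(i, j). \<bar>T (c0_basis i) (c0_basis j)\<bar> powr (4 / 3)"
  fix c assume c: "\<And>n. (\<Sum>i<n. \<Sum>j<n. \<bar>bilinear_form_coeff T i j\<bar> powr (4/3)) \<le> c"
  have total: "(\<Sum>\<^sub>\<infinity>p\<in>UNIV. ?f p) powr (3 / 4) = sqrt 2"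
    using ext by (simp add: littlewood_extremum_def)
  have nonneg: "0 \<le> (\<Sum>\<^sub>\<infinity>p\<in>UNIV. ?f p)" by (intro infsum_nonneg) auto
  have "(\<Sum>\<^sub>\<infinity>p\<in>UNIV. ?f p) = (\<Sum>\<^sub>\<infinity>p\<in>UNIV. ?f p) powr (3/4 * (4/3))"
    using nonneg by simp
  also have "\<dots> = (2 powr (1/2)) powr (4/3)"
    unfolding powr_powr[symmetric] total by (simp add: powr_half_sqrt)
  finally have total': "(\<Sum>\<^sub>\<infinity>p\<in>UNIV. ?f p) = 2 powr (2/3)" by (simp add: powr_powr)
  have "?f summable_on UNIV"
    using infsum_not_exists[of ?f UNIV] total' by force
  moreover have "sum ?f F \<le> c" if F: "finite F" for F
  proof -
    obtain n where n: "F \<subseteq> {..<n} \<times> {..<n}"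
    proof -
      have "finite (fst ` F \<union> snd ` F)" using F by simp
      then obtain n where "\<forall>k\<in>fst ` F \<union> snd ` F. k < n"
        using finite_nat_set_iff_bounded by blast
      then have "F \<subseteq> {..<n} \<times> {..<n}" by force
      then show ?thesis by (rule that)
    qed
    have "sum ?f F \<le> sum ?f ({..<n} \<times> {..<n})" using n by (intro sum_mono2) auto
    also have "\<dots> \<le> c"
      using c[of n] by (simp add: sum.cartesian_product bilinear_form_coeff_def)
    finally show ?thesis .
  qed
  ultimately have "(\<Sum>\<^sub>\<infinity>p\<in>UNIV. ?f p) \<le> c" by (intro infsum_le_finite_sums) auto
  then show "2 powr (2/3) \<le> c" unfolding total' .
qed

lemma ecard_image_inj: "inj f \<Longrightarrow> ecard (f ` A) = ecard A"
  by (simp add: ecard_def finite_image_iff card_image inj_on_subset[OF _ subset_UNIV])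

lemma S1_eq_image: "S1 T i = Pair i ` {j. bilinear_form_coeff T i j \<noteq> 0}"
  and S2_eq_image: "S2 T j = (\<lambda>i. (i, j)) ` {i. bilinear_form_coeff T i j \<noteq> 0}"
  by (auto simp: S1_def S2_def)

lemma ecard_eq_2: "card A = 2 \<Longrightarrow> ecard A = 2"
  using card_ge_0_finite[of A] by (simp add: ecard_def numeral_eq_enat)

lemma (in littlewood_extremal_matrix) ecard_row:
  "ecard {j. a i j \<noteq> 0} = (if \<exists>j. a i j \<noteq> 0 then 2 else 0)"
proof (cases "\<exists>j. a i j \<noteq> 0")
  case True
  then have "card {j. a i j \<noteq> 0} = 2" using row_two_equal_entries(1) by blast
  then show ?thesis using True by (simp add: ecard_eq_2)
qed (simp add: ecard_def zero_enat_def)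

theorem lemma3p1:
  fixes T :: "c0 \<Rightarrow> c0 \<Rightarrow> real"
  assumes "bounded_bilinear T"
    and "littlewood_extremum T"
  shows "complexity T = 2 \<and>
    (\<forall>i0 j1 j2. (i0, j1) \<in> S1 T i0 \<and> (i0, j2) \<in> S1 T i0 \<longrightarrow>
        \<bar>bilinear_form_coeff T i0 j1\<bar> = \<bar>bilinear_form_coeff T i0 j2\<bar>) \<and>
    (\<forall>j0 i1 i2. (i1, j0) \<in> S2 T j0 \<and> (i2, j0) \<in> S2 T j0 \<longrightarrow>
        \<bar>bilinear_form_coeff T i1 j0\<bar> = \<bar>bilinear_form_coeff T i2 j0\<bar>)"
proof -
  interpret rows: littlewood_extremal_matrix "bilinear_form_coeff T"
    by (rule extremum_matrix[OF assms])
  interpret cols: littlewood_extremal_matrix "\<lambda>i j. bilinear_form_coeff T j i"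
    by (rule rows.transpose)
  have row: "ecard (S1 T i) = (if \<exists>j. bilinear_form_coeff T i j \<noteq> 0 then 2 else 0)" for i
    unfolding S1_eq_image by (subst ecard_image_inj) (simp_all add: inj_def rows.ecard_row)
  have col: "ecard (S2 T j) = (if \<exists>i. bilinear_form_coeff T i j \<noteq> 0 then 2 else 0)" for j
    unfolding S2_eq_image by (subst ecard_image_inj) (simp_all add: inj_def cols.ecard_row)
  have "complexity T = 2"
  proof (rule antisym)
    show "complexity T \<le> 2"
      unfolding complexity_def by (intro sup_least SUP_least) (simp_all add: row col)
    obtain i where "\<exists>j. bilinear_form_coeff T i j \<noteq> 0" using rows.nonzero_entry by blast
    then have "2 = ecard (S1 T i)" by (simp add: row)
    also have "\<dots> \<le> complexity T"
      unfolding complexity_def by (intro le_supI1 SUP_upper) simp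
    finally show "2 \<le> complexity T" .
  qed
  moreover have "\<bar>bilinear_form_coeff T i j1\<bar> = \<bar>bilinear_form_coeff T i j2\<bar>"
    if "(i, j1) \<in> S1 T i \<and> (i, j2) \<in> S1 T i" for i j1 j2
    using that by (intro rows.row_two_equal_entries(2)) (simp_all add: S1_def)
  moreover have "\<bar>bilinear_form_coeff T i1 j\<bar> = \<bar>bilinear_form_coeff T i2 j\<bar>"
    if "(i1, j) \<in> S2 T j \<and> (i2, j) \<in> S2 T j" for j i1 i2
    using that by (intro cols.row_two_equal_entries(2)) (simp_all add: S2_def)
  ultimately show ?thesis by blast
qed

end
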